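(* Let $N$ be any finite set of terminals in the Euclidean plane admitting a bond-free full MSPT. Then a shortest total length $\mathbb{Z}$-packed tree on $N$ is an MSPT on $N$.
   Context: All lengths are Euclidean. A tree interconnecting a finite terminal set $N$, $|N|=n$, is an embedded tree with node set $N\cup W$, where $W$ is a finite set of additional nodes (Steiner points, or Steiner beads), each of degree at least three. Subdivision points are not nodes of the tree. $T^*$ denotes the tree obtained from such a $T$ by splitting nodes (introducing coincident nodes joined by zero-length edges) until every terminal has degree one and every Steiner point has degree three. It has $m=2n-3$ edges $e_1,\dots,e_m$. The bead count is $\mathrm{beads}(T)=1-n+\sum_{i=1}^m\lceil|e_i|\rceil$. An MSPT (minimum Steiner point tree) on $N$ is a tree interconnecting $N$ minimizing $\mathrm{beads}$. A full MSPT is an MSPT $T$ in which itself (not after splitting) every terminal has degree one and every Steiner bead has degree three, so it has $n-2$ Steiner beads and $2n-3$ edges. $N$ admits a tree with a property if there is a tree with that property interconnecting $N$. Two edges of an MSPT form a Steiner bond if they are incident to the same Steiner bead and are collinear. An MSPT $T$ on $N$ is bond-free if every MSPT on $N$ with the same topology as $T$ has no Steiner bonds. A tree $T$ connecting $n$ embedded terminals and some Steiner points is $\mathbb{Z}$-packed if it has a full Steiner topology (every terminal of degree one, every Steiner point of degree three) and at least $2n-4$ of its edges have integer length. *)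

theory Defs
  imports "HOL-Analysis.Analysis"
begin

type_synonym point = "real ^ 2"

record 'v graph =
  nodes :: "'v set"
  edges :: "'v set set"

definition adjacent :: "'v graph \<Rightarrow> 'v \<Rightarrow> 'v \<Rightarrow> bool" where
  "adjacent G u v \<longleftrightarrow> {u, v} \<in> edges G"

definition node_degree :: "'v graph \<Rightarrow> 'v \<Rightarrow> nat" where
  "node_degree G v = card {e \<in> edges G. v \<in> e}"

definition simple_graph :: "'v graph \<Rightarrow> bool" where
  "simple_graph G \<longleftrightarrow> finite (nodes G) \<and>
     edges G \<subseteq> {{u, v} | u v. u \<in> nodes G \<and> v \<in> nodes G \<and> u \<noteq> v}"

definition connected_graph :: "'v graph \<Rightarrow> bool" where
  "connected_graph G \<longleftrightarrow> nodes G \<noteq> {} \<and>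
     (\<forall>u\<in>nodes G. \<forall>v\<in>nodes G. (adjacent G)\<^sup>*\<^sup>* u v)"

definition acyclic_graph :: "'v graph \<Rightarrow> bool" where
  "acyclic_graph G \<longleftrightarrow> \<not> (\<exists>vs. length vs \<ge> 3 \<and> distinct vs \<and>
     successively (adjacent G) vs \<and> adjacent G (last vs) (hd vs))"

definition tree :: "'v graph \<Rightarrow> bool" where
  "tree G \<longleftrightarrow> simple_graph G \<and> connected_graph G \<and> acyclic_graph G"

text \<open>The nodes of a tree interconnecting \<open>N\<close> are points of the plane, hence pairwise distinct,
  and its edges are straight segments, represented by their pairs of endpoints; edges may cross.
  The Steiner points are the elements of \<open>nodes T - N\<close>.\<close>

definition interconnects :: "point set \<Rightarrow> point graph \<Rightarrow> bool" where
  "interconnects N T \<longleftrightarrow> tree T \<and> N \<subseteq> nodes T \<and> (\<forall>w\<in>nodes T - N. node_degree T w \<ge> 3)"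

definition full_topology :: "'v set \<Rightarrow> 'v graph \<Rightarrow> bool" where
  "full_topology N G \<longleftrightarrow>
     (\<forall>t\<in>N. node_degree G t = 1) \<and> (\<forall>w\<in>nodes G - N. node_degree G w = 3)"

text \<open>The length of an edge when the nodes are placed in the plane by \<open>pos\<close>.\<close>

definition edge_length :: "('v \<Rightarrow> point) \<Rightarrow> 'v set \<Rightarrow> real" where
  "edge_length pos e = (THE l. \<exists>u v. e = {u, v} \<and> l = dist (pos u) (pos v))"

lemma edge_length_doubleton: "edge_length pos {u, v} = dist (pos u) (pos v)"
  unfolding edge_length_def
  by (rule the_equality) (auto simp: doubleton_eq_iff dist_commute)

definition total_length :: "point graph \<Rightarrow> real" where
  "total_length T = (\<Sum>e\<in>edges T. edge_length id e)"

text \<open>Splitting creates coincident nodes, so after splitting a node is a pair \<open>(p, i)\<close>, the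
  \<open>i\<close>-th node located at the point \<open>p\<close>. Every node \<open>p\<close> of the original tree, in particular
  every terminal, is identified with \<open>(p, 0)\<close>. A split of \<open>(p, i)\<close> adds a node \<open>(p, j)\<close> and a
  zero-length edge between the two, and reattaches the edges from \<open>(p, i)\<close> to the nodes
  in \<open>A\<close> to \<open>(p, j)\<close>.\<close>

type_synonym node = "point \<times> nat"

definition unsplit :: "point graph \<Rightarrow> node graph" where
  "unsplit T = \<lparr>nodes = (\<lambda>p. (p, 0)) ` nodes T, edges = (\<lambda>e. (\<lambda>p. (p, 0)) ` e) ` edges T\<rparr>"

definition split_node :: "node graph \<Rightarrow> node graph \<Rightarrow> bool" where
  "split_node G G' \<longleftrightarrow>
     (\<exists>p i j A. (p, i) \<in> nodes G \<and> (p, j) \<notin> nodes G \<and> (\<forall>x\<in>A. adjacent G (p, i) x) \<and>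
        nodes G' = insert (p, j) (nodes G) \<and>
        edges G' = insert {(p, i), (p, j)}
          ((edges G - (\<lambda>x. {(p, i), x}) ` A) \<union> (\<lambda>x. {(p, j), x}) ` A))"

definition full_splitting :: "point set \<Rightarrow> point graph \<Rightarrow> node graph \<Rightarrow> bool" where
  "full_splitting N T S \<longleftrightarrow>
     split_node\<^sup>*\<^sup>* (unsplit T) S \<and> full_topology ((\<lambda>p. (p, 0)) ` N) S"

text \<open>A full splitting exists whenever \<open>card N \<ge> 2\<close>. Splitting keeps the lengths of the old edges
  and adds only zero-length edges, so the bead count does not depend on the choice.\<close>

definition star :: "point set \<Rightarrow> point graph \<Rightarrow> node graph" where
  "star N T = (SOME S. full_splitting N T S)"

definition beads :: "point set \<Rightarrow> point graph \<Rightarrow> int" where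
  "beads N T = 1 - int (card N) + (\<Sum>e\<in>edges (star N T). \<lceil>edge_length fst e\<rceil>)"

definition MSPT :: "point set \<Rightarrow> point graph \<Rightarrow> bool" where
  "MSPT N T \<longleftrightarrow> interconnects N T \<and> (\<forall>T'. interconnects N T' \<longrightarrow> beads N T \<le> beads N T')"

definition full_MSPT :: "point set \<Rightarrow> point graph \<Rightarrow> bool" where
  "full_MSPT N T \<longleftrightarrow> MSPT N T \<and> full_topology N T"

text \<open>Collinear edges lie on a common line; they may point in the same or in opposite directions.\<close>

definition Steiner_bond :: "point set \<Rightarrow> point graph \<Rightarrow> point set \<Rightarrow> point set \<Rightarrow> bool" where
  "Steiner_bond N T e f \<longleftrightarrow> e \<in> edges T \<and> f \<in> edges T \<and> e \<noteq> f \<and>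
     (\<exists>s\<in>nodes T - N. s \<in> e \<and> s \<in> f) \<and> collinear (e \<union> f)"

definition same_topology :: "point set \<Rightarrow> point graph \<Rightarrow> point graph \<Rightarrow> bool" where
  "same_topology N T T' \<longleftrightarrow>
     (\<exists>f. bij_betw f (nodes T) (nodes T') \<and> (\<forall>t\<in>N. f t = t) \<and> edges T' = (\<lambda>e. f ` e) ` edges T)"

definition bond_free :: "point set \<Rightarrow> point graph \<Rightarrow> bool" where
  "bond_free N T \<longleftrightarrow> MSPT N T \<and>
     (\<forall>T'. MSPT N T' \<and> same_topology N T T' \<longrightarrow> \<not> (\<exists>e f. Steiner_bond N T' e f))"

definition Z_packed :: "point set \<Rightarrow> point graph \<Rightarrow> bool" where
  "Z_packed N T \<longleftrightarrow> interconnects N T \<and> full_topology N T \<and>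
     int (card {e \<in> edges T. edge_length id e \<in> \<int>}) \<ge> 2 * int (card N) - 4"

definition shortest_Z_packed :: "point set \<Rightarrow> point graph \<Rightarrow> bool" where
  "shortest_Z_packed N T \<longleftrightarrow>
     Z_packed N T \<and> (\<forall>T'. Z_packed N T' \<longrightarrow> total_length T \<le> total_length T')"

end

theory Submission
  imports Defs
begin

text \<open>By rounding, a \<open>\<int>\<close>-packed tree \<open>T\<close> has \<open>beads(T) = 1 - n + \<lceil>length(T)\<rceil>\<close>, so it suffices to find one
  MSPT that is \<open>\<int>\<close>-packed. Fix the topology of the given bond-free full MSPT, let \<open>k e\<close> be its rounded
  edge lengths, and consider the compact set of all placements of the Steiner points for which each
  edge \<open>e\<close> is no longer than \<open>k e\<close>. Each such placement is again a full MSPT: if it were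
  not injective, a spanning tree of the collapsed graph would save a bead. Minimise the length of one
  edge \<open>f\<close> over this set. If some other edge \<open>e0\<close> were shorter than \<open>k e0\<close>, then, as
  no two edges at a Steiner point are collinear, the Steiner points could be moved so that all edges
  except \<open>e0\<close> shrink to first order, contradicting minimality. So at the minimum all
  edges but \<open>f\<close> have integer length.\<close>

section \<open>Finite graphs\<close>

lemma edges_finite: "simple_graph G \<Longrightarrow> finite (edges G)"
proof -
  assume "simple_graph G"
  then have "finite (nodes G)" "edges G \<subseteq> Pow (nodes G)" unfolding simple_graph_def by auto
  then show ?thesis by (meson finite_Pow_iff finite_subset)
qed

lemma adjacent_sym: "adjacent G u v \<longleftrightarrow> adjacent G v u"
  by (simp add: adjacent_def insert_commute)

lemma adjacent_nodes:
  assumes "simple_graph G" "adjacent G u v"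
  shows "u \<in> nodes G" "v \<in> nodes G" "u \<noteq> v"
  using assms unfolding simple_graph_def adjacent_def by (auto simp: subset_iff doubleton_eq_iff)

lemma edgeE:
  assumes "simple_graph G" "e \<in> edges G"
  obtains u v where "e = {u, v}" "u \<in> nodes G" "v \<in> nodes G" "u \<noteq> v" "adjacent G u v"
  using assms unfolding simple_graph_def adjacent_def by blast

lemma adjacent_rtranclp_sym: "(adjacent G)\<^sup>*\<^sup>* u v \<Longrightarrow> (adjacent G)\<^sup>*\<^sup>* v u"
  by (induction rule: rtranclp_induct) (auto dest: iffD1[OF adjacent_sym] intro: converse_rtranclp_into_rtranclp)

lemma connected_graphI:
  assumes "r \<in> nodes G" "\<And>v. v \<in> nodes G \<Longrightarrow> (adjacent G)\<^sup>*\<^sup>* r v"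
  shows "connected_graph G"
  unfolding connected_graph_def
  using assms(1) by (auto intro: rtranclp_trans[OF adjacent_rtranclp_sym[OF assms(2)] assms(2)])

lemma connected_graph_neighbour:
  assumes "connected_graph G" "u \<in> nodes G" "v \<in> nodes G" "u \<noteq> v"
  obtains w where "adjacent G u w"
proof -
  have "(adjacent G)\<^sup>*\<^sup>* u v" using assms by (auto simp: connected_graph_def)
  then show ?thesis using assms(4) that by (cases rule: converse_rtranclpE) auto
qed

lemma node_degree_neighbours:
  assumes "simple_graph G"
  shows "node_degree G v = card {u. adjacent G v u}"
proof -
  have "{e \<in> edges G. v \<in> e} = (\<lambda>u. {v, u}) ` {u. adjacent G v u}"
  proof (intro set_eqI iffI)
    fix e assume e: "e \<in> {e \<in> edges G. v \<in> e}"
    with assms obtain a b where "e = {a, b}" by (blast elim: edgeE)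
    with e show "e \<in> (\<lambda>u. {v, u}) ` {u. adjacent G v u}"
      by (auto simp: adjacent_def insert_commute)
  qed (auto simp: adjacent_def)
  moreover have "inj_on (\<lambda>u. {v, u}) {u. adjacent G v u}"
    by (auto simp: inj_on_def doubleton_eq_iff)
  ultimately show ?thesis unfolding node_degree_def by (simp add: card_image)
qed

lemma neighbours_finite: "simple_graph G \<Longrightarrow> finite {u. adjacent G v u}"
  by (rule finite_subset[of _ "nodes G"]) (auto dest: adjacent_nodes(2), simp add: simple_graph_def)

lemma node_degree_pos:
  assumes "simple_graph G" "connected_graph G" "u \<in> nodes G" "v \<in> nodes G" "u \<noteq> v"
  shows "node_degree G u \<ge> 1"
proof -
  obtain w where "adjacent G u w" using assms connected_graph_neighbour by metis
  then have "{u'. adjacent G u u'} \<noteq> {}" by auto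
  then show ?thesis
    using neighbours_finite[OF assms(1)] node_degree_neighbours[OF assms(1)]
    by (simp add: card_gt_0_iff Suc_le_eq)
qed

lemma sum_node_degree:
  assumes "simple_graph G"
  shows "(\<Sum>v\<in>nodes G. node_degree G v) = 2 * card (edges G)"
  unfolding node_degree_def
proof (rule sum_multicount)
  show "finite (nodes G)" "finite (edges G)" using assms edges_finite by (auto simp: simple_graph_def)
  show "\<forall>e\<in>edges G. card {v \<in> nodes G. v \<in> e} = 2"
  proof
    fix e assume "e \<in> edges G"
    with assms obtain u v where e: "e = {u, v}" "u \<in> nodes G" "v \<in> nodes G" "u \<noteq> v" by (rule edgeE)
    then have "{v \<in> nodes G. v \<in> e} = {u, v}" by auto
    with e show "card {v \<in> nodes G. v \<in> e} = 2" by simp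
  qed
qed

section \<open>Paths, spanning trees and edge counts\<close>

text \<open>Loop erasure: if the vertex put in front already lies on the path, the path is restarted
  at that occurrence.\<close>

lemma rtranclp_distinct_path:
  assumes "R\<^sup>*\<^sup>* u v"
  shows "\<exists>vs. vs \<noteq> [] \<and> hd vs = u \<and> last vs = v \<and> distinct vs \<and> successively R vs"
  using assms
proof (induction rule: converse_rtranclp_induct)
  case base
  then show ?case by (intro exI[of _ "[v]"]) auto
next
  case (step u w)
  then obtain vs where vs: "vs \<noteq> []" "hd vs = w" "last vs = v" "distinct vs" "successively R vs"
    by blast
  show ?case
  proof (cases "u \<in> set vs")
    case True
    then obtain xs ys where "vs = xs @ u # ys" by (meson split_list)
    with vs show ?thesis
      by (intro exI[of _ "u # ys"]) (auto simp: successively_append_iff)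
  next
    case False
    with vs step show ?thesis by (intro exI[of _ "u # vs"]) (auto simp: successively_Cons)
  qed
qed

lemma successively_rtranclp: "successively R vs \<Longrightarrow> vs \<noteq> [] \<Longrightarrow> R\<^sup>*\<^sup>* (hd vs) (last vs)"
  by (induction vs) (auto simp: successively_Cons intro: converse_rtranclp_into_rtranclp)

text \<open>Breadth-first search from \<open>r\<close>: \<open>p\<close> is the parent function, \<open>d\<close> the depth.\<close>

lemma connected_graph_parents:
  assumes "connected_graph G" "r \<in> nodes G"
  obtains p d where "\<forall>v\<in>nodes G - {r}. adjacent G (p v) v \<and> d v = Suc (d (p v))"
proof -
  define d where "d v = (LEAST k. (adjacent G ^^ k) r v)" for v
  have "\<exists>u. adjacent G u v \<and> d v = Suc (d u)" if v: "v \<in> nodes G" "v \<noteq> r" for v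
  proof -
    have "(adjacent G)\<^sup>*\<^sup>* r v" using assms v by (auto simp: connected_graph_def)
    then have "\<exists>k. (adjacent G ^^ k) r v" by (simp add: rtranclp_power)
    then have dv: "(adjacent G ^^ d v) r v" unfolding d_def by (rule LeastI_ex)
    \<comment> \<open>The last step of a shortest walk to \<open>v\<close> starts at a node
      \<open>u\<close> that is exactly one level closer to the root.\<close>
    with v obtain k where k: "d v = Suc k" by (cases "d v") auto
    with dv obtain u where u: "(adjacent G ^^ k) r u" "adjacent G u v" by auto
    have "d u \<le> k" unfolding d_def using u by (intro Least_le)
    moreover have "(adjacent G ^^ d u) r u" unfolding d_def using u by (intro LeastI)
    then have "(adjacent G ^^ Suc (d u)) r v" using u by auto
    then have "d v \<le> Suc (d u)" unfolding d_def[of v] by (rule Least_le)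
    ultimately show ?thesis using u k by (intro exI[of _ u]) auto
  qed
  then obtain p where "\<forall>v\<in>nodes G - {r}. adjacent G (p v) v \<and> d v = Suc (d (p v))"
    by (metis Diff_iff insertCI)
  then show ?thesis by (rule that)
qed

text \<open>If two vertices gave the same edge, each would be the parent of the other and hence
  deeper than itself.\<close>

lemma parent_edges_inj:
  fixes d :: "'v \<Rightarrow> nat"
  assumes "\<And>v. v \<in> A \<Longrightarrow> d v = Suc (d (p v))"
  shows "inj_on (\<lambda>v. {p v, v}) A"
proof (rule inj_onI)
  fix u v assume uv: "u \<in> A" "v \<in> A" "{p u, u} = {p v, v}"
  show "u = v"
  proof (rule ccontr)
    assume "u \<noteq> v"
    with uv have "p u = v" "p v = u" by (auto simp: doubleton_eq_iff)
    with assms[OF uv(1)] assms[OF uv(2)] show False by simp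
  qed
qed

text \<open>Induction on the depth: going to the parent lowers it by one, and only the root can have
  depth 0.\<close>

lemma parent_edges_connected:
  fixes d :: "'v \<Rightarrow> nat"
  assumes "r \<in> nodes H"
    and "\<And>v. v \<in> nodes H \<Longrightarrow> v \<noteq> r \<Longrightarrow> p v \<in> nodes H \<and> adjacent H (p v) v \<and> d v = Suc (d (p v))"
  shows "connected_graph H"
proof (rule connected_graphI)
  show "r \<in> nodes H" by fact
  show "(adjacent H)\<^sup>*\<^sup>* r v" if "v \<in> nodes H" for v
    using that
  proof (induction "d v" arbitrary: v)
    case 0
    then show ?case using assms(2)[of v] by (cases "v = r") auto
  next
    case (Suc k)
    then show ?case using assms(2)[of v]
      by (cases "v = r") (auto intro: rtranclp.rtrancl_into_rtrancl)
  qed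
qed

lemma spanning_tree_parents:
  assumes "simple_graph G" "connected_graph G" "r \<in> nodes G"
  obtains p d where "\<forall>v\<in>nodes G - {r}. p v \<in> nodes G \<and> d v = Suc (d (p v))"
    "(\<lambda>v. {p v, v}) ` (nodes G - {r}) \<subseteq> edges G"
    "card ((\<lambda>v. {p v, v}) ` (nodes G - {r})) + 1 = card (nodes G)"
    "connected_graph \<lparr>nodes = nodes G, edges = (\<lambda>v. {p v, v}) ` (nodes G - {r})\<rparr>"
proof -
  obtain p and d :: "'a \<Rightarrow> nat"
    where pd: "\<forall>v\<in>nodes G - {r}. adjacent G (p v) v \<and> d v = Suc (d (p v))"
    by (rule connected_graph_parents[OF assms(2,3)])
  let ?P = "(\<lambda>v. {p v, v}) ` (nodes G - {r})"
  have fin: "finite (nodes G)" using assms by (simp add: simple_graph_def)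
  have 1: "p v \<in> nodes G \<and> d v = Suc (d (p v))" if "v \<in> nodes G - {r}" for v
    using that pd adjacent_nodes[OF assms(1)] by auto
  have 2: "?P \<subseteq> edges G" using pd by (auto simp: adjacent_def)
  have "card ?P = card (nodes G - {r})"
    using 1 by (intro card_image parent_edges_inj[of _ d]) auto
  then have 3: "card ?P + 1 = card (nodes G)"
    using fin assms(3) by (simp add: card_gt_0_iff) (metis Suc_pred card_gt_0_iff empty_iff)
  have 4: "connected_graph \<lparr>nodes = nodes G, edges = ?P\<rparr>"
    by (rule parent_edges_connected[of r _ p d]) (use assms 1 in \<open>auto simp: adjacent_def\<close>)
  show ?thesis using that[OF _ 2 3 4] 1 by blast
qed

lemma connected_card_edges:
  assumes "simple_graph G" "connected_graph G"
  shows "card (nodes G) \<le> card (edges G) + 1"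
proof -
  obtain r where "r \<in> nodes G" using assms by (auto simp: connected_graph_def)
  then obtain p :: "'a \<Rightarrow> 'a" and d :: "'a \<Rightarrow> nat" where "(\<lambda>v. {p v, v}) ` (nodes G - {r}) \<subseteq> edges G"
    "card ((\<lambda>v. {p v, v}) ` (nodes G - {r})) + 1 = card (nodes G)"
    by (rule spanning_tree_parents[OF assms])
  then show ?thesis using card_mono[OF edges_finite[OF assms(1)]] by (metis add_le_cancel_right)
qed

text \<open>An edge outside the breadth-first tree would close a cycle with the tree path between
  its ends, so acyclicity leaves the parent edges only.\<close>

lemma tree_parents:
  assumes "tree G" "r \<in> nodes G"
  obtains p d where "\<forall>v\<in>nodes G - {r}. p v \<in> nodes G \<and> d v = Suc (d (p v))"
    "edges G = (\<lambda>v. {p v, v}) ` (nodes G - {r})" "card (edges G) + 1 = card (nodes G)"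
proof -
  have G: "simple_graph G" "connected_graph G" "acyclic_graph G" using assms by (auto simp: tree_def)
  obtain p d where p: "\<forall>v\<in>nodes G - {r}. p v \<in> nodes G \<and> d v = Suc (d (p v))"
    and P: "(\<lambda>v. {p v, v}) ` (nodes G - {r}) \<subseteq> edges G"
    "card ((\<lambda>v. {p v, v}) ` (nodes G - {r})) + 1 = card (nodes G)"
    "connected_graph \<lparr>nodes = nodes G, edges = (\<lambda>v. {p v, v}) ` (nodes G - {r})\<rparr>"
    by (rule spanning_tree_parents[OF G(1,2) assms(2)])
  define H where "H = \<lparr>nodes = nodes G, edges = (\<lambda>v. {p v, v}) ` (nodes G - {r})\<rparr>"
  have "e \<in> edges H" if e: "e \<in> edges G" for e
  proof (rule ccontr)
    assume not: "e \<notin> edges H"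
    obtain u v where uv: "e = {u, v}" "u \<in> nodes G" "v \<in> nodes G" "u \<noteq> v"
      using G(1) e by (rule edgeE)
    then have "(adjacent H)\<^sup>*\<^sup>* u v"
      using P(3) unfolding H_def connected_graph_def by auto
    then obtain vs where vs: "vs \<noteq> []" "hd vs = u" "last vs = v" "distinct vs"
      "successively (adjacent H) vs" using rtranclp_distinct_path by metis
    \<comment> \<open>One vertex would mean \<open>u = v\<close>, and two would make
      \<open>e\<close> itself an edge of \<open>H\<close>. So the path is long enough to form a
      cycle with \<open>e\<close>.\<close>
    have "length vs \<noteq> 1" using vs uv by (auto simp: length_Suc_conv)
    moreover have "length vs \<noteq> 2"
      using vs uv not by (auto simp: length_Suc_conv numeral_2_eq_2 adjacent_def)
    ultimately have "length vs \<ge> 3" using vs(1)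
      by (metis One_nat_def Suc_1 length_0_conv not_less_eq_eq numeral_3_eq_3 le_antisym le_0_eq)
    moreover have "successively (adjacent G) vs"
      using vs(5) by (rule successively_mono) (use P(1) in \<open>auto simp: adjacent_def H_def\<close>)
    moreover have "adjacent G (last vs) (hd vs)"
      using vs e uv by (simp add: adjacent_def insert_commute)
    ultimately show False using G(3) vs(4) by (auto simp: acyclic_graph_def)
  qed
  then have "edges G = (\<lambda>v. {p v, v}) ` (nodes G - {r})" using P(1) by (auto simp: H_def)
  with that[OF p this] P(2) show ?thesis by simp
qed

lemma card_edges_tree: "tree G \<Longrightarrow> card (edges G) + 1 = card (nodes G)"
proof -
  assume G: "tree G"
  then obtain r where "r \<in> nodes G" by (auto simp: tree_def connected_graph_def)
  with G show ?thesis by (rule tree_parents)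
qed

text \<open>Removing one edge of a cycle keeps the graph connected, since the rest of the cycle is a
  detour. A connected graph with this few edges has none to spare.\<close>

lemma acyclic_graph_if_few_edges:
  assumes G: "simple_graph G" "connected_graph G" and card: "card (edges G) < card (nodes G)"
  shows "acyclic_graph G"
  unfolding acyclic_graph_def
proof
  assume "\<exists>vs. length vs \<ge> 3 \<and> distinct vs \<and>
     successively (adjacent G) vs \<and> adjacent G (last vs) (hd vs)"
  then obtain vs where vs: "length vs \<ge> 3" "distinct vs" "successively (adjacent G) vs"
    "adjacent G (last vs) (hd vs)" by blast
  define H where "H = \<lparr>nodes = nodes G, edges = edges G - {{last vs, hd vs}}\<rparr>"
  have H: "simple_graph H" using G(1) by (auto simp: H_def simple_graph_def)
  have ne: "vs \<noteq> []" using vs(1) by auto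
  have "successively (adjacent H) vs"
    unfolding successively_conv_nth
  proof (intro allI impI)
    fix i assume i: "Suc i < length vs"
    \<comment> \<open>The closing edge differs from all consecutive ones, because the vertices are
      distinct and there are at least three of them.\<close>
    have "{vs ! i, vs ! Suc i} \<noteq> {last vs, hd vs}"
      using i vs(1,2) ne
      by (auto simp: doubleton_eq_iff last_conv_nth hd_conv_nth nth_eq_iff_index_eq)
    moreover have "adjacent G (vs ! i) (vs ! Suc i)"
      using vs(3) i by (auto simp: successively_conv_nth)
    ultimately show "adjacent H (vs ! i) (vs ! Suc i)" by (auto simp: adjacent_def H_def)
  qed
  then have path: "(adjacent H)\<^sup>*\<^sup>* (hd vs) (last vs)" using successively_rtranclp ne by blast
  have step: "(adjacent H)\<^sup>*\<^sup>* u v" if "adjacent G u v" for u v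
  proof (cases "{u, v} = {last vs, hd vs}")
    case True
    then show ?thesis using path adjacent_rtranclp_sym by (auto simp: doubleton_eq_iff)
  next
    case False
    with that have "adjacent H u v" by (auto simp: H_def adjacent_def)
    then show ?thesis by blast
  qed
  have "(adjacent H)\<^sup>*\<^sup>* u v" if "(adjacent G)\<^sup>*\<^sup>* u v" for u v
    using that by (induction rule: rtranclp_induct) (auto intro: rtranclp_trans step)
  then have "connected_graph H" using G(2) by (auto simp: connected_graph_def H_def)
  then have "card (nodes G) \<le> card (edges H) + 1" using connected_card_edges[OF H] by (simp add: H_def)
  moreover have "card (edges H) < card (edges G)"
    using vs(4) edges_finite[OF G(1)] unfolding H_def adjacent_def
    by (intro psubset_card_mono) auto
  ultimately show False using card by simp
qed

lemma spanning_tree: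
  assumes "simple_graph G" "connected_graph G"
  obtains H where "simple_graph H" "connected_graph H" "nodes H = nodes G" "edges H \<subseteq> edges G"
    "card (edges H) + 1 = card (nodes H)"
proof -
  obtain r where "r \<in> nodes G" using assms by (auto simp: connected_graph_def)
  then obtain p :: "'a \<Rightarrow> 'a" and d :: "'a \<Rightarrow> nat" where p: "(\<lambda>v. {p v, v}) ` (nodes G - {r}) \<subseteq> edges G"
    "card ((\<lambda>v. {p v, v}) ` (nodes G - {r})) + 1 = card (nodes G)"
    "connected_graph \<lparr>nodes = nodes G, edges = (\<lambda>v. {p v, v}) ` (nodes G - {r})\<rparr>"
    by (rule spanning_tree_parents[OF assms])
  show ?thesis
  proof
    show "simple_graph \<lparr>nodes = nodes G, edges = (\<lambda>v. {p v, v}) ` (nodes G - {r})\<rparr>"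
      using assms(1) p(1) unfolding simple_graph_def by auto
  qed (use p in auto)
qed

text \<open>With \<open>n\<close> terminals, \<open>s\<close> Steiner points and \<open>m\<close>
  edges, the degree sum gives \<open>2 m = n + 3 s\<close> and the tree property gives
  \<open>m + 1 = n + s\<close>. Eliminating \<open>s\<close> yields \<open>m + 3 = 2 n\<close>, so
  \<open>2 n\<close> is at least 3.\<close>

lemma full_topology_card:
  assumes "tree G" "N \<subseteq> nodes G" "full_topology N G"
  shows "card (edges G) + 3 = 2 * card N" "card N \<ge> 2"
proof -
  have G: "simple_graph G" and fin: "finite (nodes G)"
    using assms(1) by (auto simp: tree_def simple_graph_def)
  have "(\<Sum>v\<in>nodes G. node_degree G v)
      = (\<Sum>v\<in>N. node_degree G v) + (\<Sum>v\<in>nodes G - N. node_degree G v)"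
    using fin assms(2) by (metis add.commute sum.subset_diff)
  also have "\<dots> = card N + 3 * card (nodes G - N)"
    using assms(3) by (simp add: full_topology_def)
  finally have "2 * card (edges G) = card N + 3 * card (nodes G - N)"
    using sum_node_degree[OF G] by simp
  moreover have "card (nodes G) = card N + card (nodes G - N)"
    using fin assms(2) by (metis card_Diff_subset card_mono finite_subset le_add_diff_inverse)
  moreover note card_edges_tree[OF assms(1)]
  ultimately show "card (edges G) + 3 = 2 * card N" "card N \<ge> 2" by linarith+
qed

section \<open>Images of graphs\<close>

definition map_graph :: "('v \<Rightarrow> 'w) \<Rightarrow> 'v graph \<Rightarrow> 'w graph" where
  "map_graph f G = \<lparr>nodes = f ` nodes G, edges = (\<lambda>e. f ` e) ` edges G\<rparr>"

lemma edges_subset_Pow: "simple_graph G \<Longrightarrow> edges G \<subseteq> Pow (nodes G)"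
  unfolding simple_graph_def by auto

lemma inj_on_edges:
  assumes "simple_graph G" "inj_on f (nodes G)"
  shows "inj_on (\<lambda>e. f ` e) (edges G)"
  using inj_on_subset[OF inj_on_image_Pow[OF assms(2)] edges_subset_Pow[OF assms(1)]] .

lemma simple_map_graph:
  assumes "simple_graph G" "inj_on f (nodes G)"
  shows "simple_graph (map_graph f G)"
proof -
  have "f ` e \<in> {{u, v} |u v. u \<in> f ` nodes G \<and> v \<in> f ` nodes G \<and> u \<noteq> v}" if e: "e \<in> edges G" for e
  proof -
    obtain u v where "e = {u, v}" "u \<in> nodes G" "v \<in> nodes G" "u \<noteq> v"
      using assms(1) e by (rule edgeE)
    then have "f ` e = {f u, f v}" "f u \<in> f ` nodes G" "f v \<in> f ` nodes G" "f u \<noteq> f v"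
      using assms(2) by (auto simp: inj_on_def)
    then show ?thesis by blast
  qed
  then show ?thesis using assms(1) unfolding simple_graph_def map_graph_def by auto
qed

lemma map_graph_rtranclp:
  assumes "\<And>u v. adjacent G u v \<Longrightarrow> f u = f v \<or> adjacent H (f u) (f v)"
  shows "(adjacent G)\<^sup>*\<^sup>* u v \<Longrightarrow> (adjacent H)\<^sup>*\<^sup>* (f u) (f v)"
proof (induction rule: rtranclp_induct)
  case (step v w)
  then show ?case using assms[OF step(2)] by (auto intro: rtranclp.rtrancl_into_rtrancl)
qed simp

text \<open>The alternative \<open>f u = f v\<close> admits maps that collapse edges, as happens
  when a placement makes nodes coincide.\<close>

lemma connected_map_graph:
  assumes "connected_graph G" "nodes H = f ` nodes G"
    and "\<And>u v. adjacent G u v \<Longrightarrow> f u = f v \<or> adjacent H (f u) (f v)"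
  shows "connected_graph H"
  using assms(1,2) map_graph_rtranclp[of G f H, OF assms(3)] unfolding connected_graph_def by auto

lemma node_degree_map_graph:
  assumes "simple_graph G" "inj_on f (nodes G)" "v \<in> nodes G"
  shows "node_degree (map_graph f G) (f v) = node_degree G v"
proof -
  have "f v \<in> f ` e \<longleftrightarrow> v \<in> e" if "e \<in> edges G" for e
    using assms that edges_subset_Pow[OF assms(1)] by (intro inj_on_image_mem_iff) auto
  then have "{e \<in> edges (map_graph f G). f v \<in> e} = (\<lambda>e. f ` e) ` {e \<in> edges G. v \<in> e}"
    by (auto simp: map_graph_def)
  then show ?thesis unfolding node_degree_def
    by (simp only:) (intro card_image inj_on_subset[OF inj_on_edges[OF assms(1,2)]], auto)
qed

lemma edge_length_image:
  assumes "simple_graph G" "e \<in> edges G"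
  shows "edge_length pos (f ` e) = edge_length (pos \<circ> f) e"
  using assms(1,2) by (rule edgeE) (simp add: edge_length_doubleton)

lemma sum_edges_map_graph:
  assumes "simple_graph G" "inj_on f (nodes G)"
  shows "(\<Sum>e\<in>edges (map_graph f G). h (edge_length pos e))
       = (\<Sum>e\<in>edges G. h (edge_length (pos \<circ> f) e))"
  by (simp add: map_graph_def sum.reindex[OF inj_on_edges[OF assms]] edge_length_image[OF assms(1)]
      cong: sum.cong)

lemma card_edges_map_graph:
  assumes "simple_graph G" "inj_on f (nodes G)"
  shows "card (edges (map_graph f G)) = card (edges G)"
  by (simp add: map_graph_def card_image[OF inj_on_edges[OF assms]])

lemma full_topology_map_graph:
  assumes "simple_graph G" "inj_on f (nodes G)" "N \<subseteq> nodes G"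
  shows "full_topology (f ` N) (map_graph f G) \<longleftrightarrow> full_topology N G"
proof -
  have "nodes (map_graph f G) - f ` N = f ` (nodes G - N)"
    using inj_on_image_set_diff[OF assms(2), of "nodes G" N] assms(3) by (simp add: map_graph_def)
  then show ?thesis using assms(3) node_degree_map_graph[OF assms(1,2)]
    by (auto simp: full_topology_def subset_iff)
qed

text \<open>Acyclicity comes from counting edges against nodes, which avoids pulling cycles back
  along \<open>f\<close>.\<close>

lemma tree_map_graph:
  assumes "tree G" "inj_on f (nodes G)"
  shows "tree (map_graph f G)"
proof -
  have G: "simple_graph G" "connected_graph G" using assms(1) by (auto simp: tree_def)
  have S: "simple_graph (map_graph f G)" using simple_map_graph G(1) assms(2) by blast
  have adj: "adjacent (map_graph f G) (f u) (f v)" if "adjacent G u v" for u v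
    using imageI[OF that[unfolded adjacent_def], of "image f"]
    by (simp add: map_graph_def adjacent_def)
  have C: "connected_graph (map_graph f G)"
    using G(2) by (rule connected_map_graph[of _ _ f]) (use adj in \<open>simp_all add: map_graph_def\<close>)
  have "card (edges (map_graph f G)) < card (nodes (map_graph f G))"
    using card_edges_tree[OF assms(1)] card_edges_map_graph[OF G(1) assms(2)] card_image[OF assms(2)]
    by (simp add: map_graph_def)
  then show ?thesis using S C acyclic_graph_if_few_edges[OF S C] by (simp add: tree_def)
qed

section \<open>Splitting nodes\<close>

text \<open>Functional form of one splitting step, for arbitrary vertices \<open>v\<close> and
  \<open>w\<close> in place of the pairs at a common point.\<close>

definition split_graph :: "'v graph \<Rightarrow> 'v \<Rightarrow> 'v \<Rightarrow> 'v set \<Rightarrow> 'v graph" where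
  "split_graph G v w A = \<lparr>nodes = insert w (nodes G),
     edges = insert {v, w} ((edges G - (\<lambda>x. {v, x}) ` A) \<union> (\<lambda>x. {w, x}) ` A)\<rparr>"

lemma split_node_split_graph:
  "split_node G G' \<longleftrightarrow> (\<exists>p i j A. (p, i) \<in> nodes G \<and> (p, j) \<notin> nodes G \<and>
     A \<subseteq> {x. adjacent G (p, i) x} \<and> G' = split_graph G (p, i) (p, j) A)"
proof -
  have "G' = \<lparr>nodes = V, edges = E\<rparr> \<longleftrightarrow> nodes G' = V \<and> edges G' = E" for V E
    by (cases G') simp
  then show ?thesis unfolding split_node_def split_graph_def subset_iff mem_Collect_eq Ball_def by (simp only:)
qed

context
  fixes G :: "'v graph" and v w :: 'v and A :: "'v set"
  assumes G: "simple_graph G" and v: "v \<in> nodes G" and w: "w \<notin> nodes G"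
    and A: "A \<subseteq> {x. adjacent G v x}"
begin

lemma split_nodes_subset: "A \<subseteq> nodes G" "v \<notin> A" "w \<notin> A" "v \<noteq> w" "finite A"
proof -
  show 1: "A \<subseteq> nodes G" using A adjacent_nodes[OF G] by auto
  show "v \<notin> A" using A adjacent_nodes[OF G] by blast
  show "w \<notin> A" "v \<noteq> w" using 1 v w by auto
  show "finite A" using 1 G by (auto simp: simple_graph_def intro: finite_subset)
qed

lemma simple_split_graph: "simple_graph (split_graph G v w A)"
proof -
  note B = split_nodes_subset
  define D where "D = {{u, v} |u v. u \<in> insert w (nodes G) \<and> v \<in> insert w (nodes G) \<and> u \<noteq> v}"
  have "(\<lambda>x. {w, x}) ` A \<subseteq> D" unfolding D_def using B by blast
  moreover have "{v, w} \<in> D" unfolding D_def using B v by blast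
  moreover have "edges G \<subseteq> D" using G unfolding simple_graph_def D_def by blast
  ultimately have "edges (split_graph G v w A) \<subseteq> D" unfolding split_graph_def by auto
  moreover have "finite (nodes (split_graph G v w A))" "nodes (split_graph G v w A) = insert w (nodes G)"
    using G by (simp_all add: simple_graph_def split_graph_def)
  ultimately show ?thesis unfolding simple_graph_def D_def by simp
qed

text \<open>By assumption reattachment preserves weights, so only the new edge contributes. Constant
  weight 1 makes this a count of edges.\<close>

lemma sum_edges_split_graph:
  assumes "\<And>x. x \<in> A \<Longrightarrow> h {w, x} = h {v, x}"
  shows "(\<Sum>e\<in>edges (split_graph G v w A). h e) = h {v, w} + (\<Sum>e\<in>edges G. h e)"
proof -
  note B = split_nodes_subset
  let ?X = "(\<lambda>x. {v, x}) ` A" and ?Y = "(\<lambda>x. {w, x}) ` A"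
  have fin: "finite (edges G)" using G by (rule edges_finite)
  have w': "w \<notin> e" if "e \<in> edges G" for e using edges_subset_Pow[OF G] that w by auto
  have X: "?X \<subseteq> edges G" using A by (auto simp: adjacent_def)
  have "{v, w} \<notin> (edges G - ?X) \<union> ?Y" using w'[of "{v, w}"] B by (auto simp: doubleton_eq_iff)
  then have "(\<Sum>e\<in>edges (split_graph G v w A). h e) = h {v, w} + (\<Sum>e\<in>(edges G - ?X) \<union> ?Y. h e)"
    using fin B(5) by (simp add: split_graph_def)
  also have "(\<Sum>e\<in>(edges G - ?X) \<union> ?Y. h e) = (\<Sum>e\<in>edges G - ?X. h e) + (\<Sum>e\<in>?Y. h e)"
    using fin B(5) w' by (intro sum.union_disjoint) auto
  also have "(\<Sum>e\<in>?Y. h e) = (\<Sum>x\<in>A. h {w, x})"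
    by (subst sum.reindex) (auto simp: inj_on_def doubleton_eq_iff)
  also have "\<dots> = (\<Sum>e\<in>?X. h e)"
    by (subst sum.reindex) (auto simp: inj_on_def doubleton_eq_iff assms)
  also have "(\<Sum>e\<in>edges G - ?X. h e) + (\<Sum>e\<in>?X. h e) = (\<Sum>e\<in>edges G. h e)"
    using fin X by (metis sum.subset_diff)
  finally show ?thesis .
qed

lemma card_edges_split_graph: "card (edges (split_graph G v w A)) = card (edges G) + 1"
  using sum_edges_split_graph[of "\<lambda>_. 1 :: nat"] by simp

lemma card_nodes_split_graph: "card (nodes (split_graph G v w A)) = card (nodes G) + 1"
  using G w by (simp add: split_graph_def simple_graph_def)

lemma adjacent_split_graph:
  "adjacent (split_graph G v w A) x y \<longleftrightarrow>
     x = v \<and> y = w \<or> x = w \<and> y = v \<or> x = w \<and> y \<in> A \<or> x \<in> A \<and> y = w \<or>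
     adjacent G x y \<and> \<not> (x = v \<and> y \<in> A) \<and> \<not> (x \<in> A \<and> y = v)"
proof -
  have "{x, y} \<in> (\<lambda>x. {z, x}) ` A \<longleftrightarrow> x = z \<and> y \<in> A \<or> x \<in> A \<and> y = z" for z
    by (auto simp: image_iff doubleton_eq_iff)
  then show ?thesis
    unfolding adjacent_def split_graph_def graph.select_convs insert_iff Un_iff Diff_iff doubleton_eq_iff
    by metis
qed

lemma not_adjacent_new: "\<not> adjacent G w x" "\<not> adjacent G x w"
  using adjacent_nodes[OF G] w by blast+

text \<open>The node \<open>v\<close> gives up its edges into \<open>A\<close> and gains the one to
  \<open>w\<close>. The additive form avoids truncated subtraction.\<close>

lemma node_degree_split_graph_old:
  "node_degree (split_graph G v w A) v + card A = node_degree G v + 1"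
proof -
  note B = split_nodes_subset
  have "{x. adjacent (split_graph G v w A) v x} = insert w ({x. adjacent G v x} - A)"
    using B by (auto simp: adjacent_split_graph)
  then have "card {x. adjacent (split_graph G v w A) v x} = Suc (card ({x. adjacent G v x} - A))"
    using neighbours_finite[OF G] not_adjacent_new by simp
  moreover have "card ({x. adjacent G v x} - A) + card A = card {x. adjacent G v x}"
    using A neighbours_finite[OF G, of v]
    by (metis B(5) card_Diff_subset card_mono le_add_diff_inverse2)
  ultimately show ?thesis
    by (simp add: node_degree_neighbours G simple_split_graph)
qed

lemma node_degree_split_graph_new: "node_degree (split_graph G v w A) w = card A + 1"
proof -
  note B = split_nodes_subset
  have "{x. adjacent (split_graph G v w A) w x} = insert v A"
    using B not_adjacent_new by (auto simp: adjacent_split_graph)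
  then show ?thesis using B
    by (simp add: node_degree_neighbours G simple_split_graph)
qed

lemma node_degree_split_graph_other:
  assumes "u \<noteq> v" "u \<noteq> w"
  shows "node_degree (split_graph G v w A) u = node_degree G u"
proof (cases "u \<in> A")
  case True
  note B = split_nodes_subset
  have "{x. adjacent (split_graph G v w A) u x} = insert w ({x. adjacent G u x} - {v})"
    using B True assms not_adjacent_new by (auto simp: adjacent_split_graph)
  then have "card {x. adjacent (split_graph G v w A) u x} = Suc (card ({x. adjacent G u x} - {v}))"
    using neighbours_finite[OF G] not_adjacent_new by simp
  also have "\<dots> = card {x. adjacent G u x}"
    using True A neighbours_finite[OF G, of u]
    by (intro card_Suc_Diff1) (auto simp: adjacent_sym[of _ u])
  finally show ?thesis
    by (simp add: node_degree_neighbours G simple_split_graph)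
next
  case False
  then have "{x. adjacent (split_graph G v w A) u x} = {x. adjacent G u x}"
    using assms by (auto simp: adjacent_split_graph)
  then show ?thesis
    by (simp add: node_degree_neighbours G simple_split_graph)
qed

end

text \<open>Both halves of the split node lie at the same point \<open>p\<close>, so reattached
  edges keep their lengths and the new edge has length 0.\<close>

lemma split_node_invariant:
  assumes "split_node G G'" "simple_graph G"
  shows "simple_graph G' \<and>
    (\<Sum>e\<in>edges G'. \<lceil>edge_length fst e\<rceil>) = (\<Sum>e\<in>edges G. \<lceil>edge_length fst e\<rceil>)"
proof -
  obtain p i j A where s: "(p, i) \<in> nodes G" "(p, j) \<notin> nodes G"
    "A \<subseteq> {x. adjacent G (p, i) x}" "G' = split_graph G (p, i) (p, j) A"
    using assms(1) unfolding split_node_split_graph by blast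
  show ?thesis unfolding s(4)
    using simple_split_graph[OF assms(2) s(1-3)]
      sum_edges_split_graph[OF assms(2) s(1-3), of "\<lambda>e. \<lceil>edge_length fst e\<rceil>"]
    by (simp add: edge_length_doubleton)
qed

lemma split_nodes_invariant:
  assumes "split_node\<^sup>*\<^sup>* G G'" "simple_graph G"
  shows "simple_graph G' \<and>
    (\<Sum>e\<in>edges G'. \<lceil>edge_length fst e\<rceil>) = (\<Sum>e\<in>edges G. \<lceil>edge_length fst e\<rceil>)"
  using assms by (induction rule: rtranclp_induct) (auto dest: split_node_invariant)

text \<open>A node with too high a degree is split as long as there is one. A split adds one node
  and one edge, which lowers \<open>2 * card N + 2 * card (edges G) - 3 * card (nodes G)\<close> by
  one, and the degree sum keeps this quantity nonnegative.\<close>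

lemma exists_full_topology_splitting:
  fixes G :: "node graph"
  assumes "simple_graph G" "N \<subseteq> nodes G" "\<forall>t\<in>N. node_degree G t \<ge> 1"
    "\<forall>w\<in>nodes G - N. node_degree G w \<ge> 3"
  shows "\<exists>S. split_node\<^sup>*\<^sup>* G S \<and> full_topology N S"
  using assms
proof (induction "2 * card N + 2 * card (edges G) - 3 * card (nodes G)" arbitrary: G rule: less_induct)
  case less
  have bound: "3 * card (nodes H) \<le> 2 * card N + 2 * card (edges H)"
    if "simple_graph H" "N \<subseteq> nodes H" "\<forall>t\<in>N. node_degree H t \<ge> 1"
      "\<forall>w\<in>nodes H - N. node_degree H w \<ge> 3" for H :: "node graph"
  proof -
    have fin: "finite (nodes H)" using that(1) by (simp add: simple_graph_def)
    have "card N + 3 * card (nodes H - N) = (\<Sum>v\<in>N. 1) + (\<Sum>v\<in>nodes H - N. 3)" by simp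
    also have "\<dots> \<le> (\<Sum>v\<in>N. node_degree H v) + (\<Sum>v\<in>nodes H - N. node_degree H v)"
      using that by (intro add_mono sum_mono) auto
    also have "\<dots> = (\<Sum>v\<in>nodes H. node_degree H v)"
      using fin that(2) by (metis add.commute sum.subset_diff)
    also have "\<dots> = 2 * card (edges H)" using sum_node_degree[OF that(1)] .
    finally have "card N + 3 * card (nodes H - N) \<le> 2 * card (edges H)" .
    moreover have "card (nodes H) = card N + card (nodes H - N)"
      using fin that(2) by (metis card_Diff_subset card_mono finite_subset le_add_diff_inverse)
    ultimately show ?thesis by simp
  qed
  show ?case
  proof (cases "full_topology N G")
    case True
    then show ?thesis by blast
  next
    case False
    then obtain v where v: "v \<in> nodes G" "v \<in> N \<and> node_degree G v \<noteq> 1 \<or> v \<notin> N \<and> node_degree G v \<noteq> 3"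
      using less.prems(2) by (auto simp: full_topology_def)
    then have deg: "if v \<in> N then node_degree G v \<ge> 2 else node_degree G v \<ge> 4"
      using bspec[OF less.prems(3), of v] bspec[OF less.prems(4), of v] by (cases "v \<in> N") auto
    \<comment> \<open>A terminal may pass all its edges to the new node and keep only the connecting
      edge. A Steiner node of degree at least four passes on two, so that both halves have degree at
      least three.\<close>
    have "\<exists>A. A \<subseteq> {x. adjacent G v x} \<and> card A \<ge> 2 \<and>
        (if v \<in> N then card A \<le> node_degree G v else card A + 2 \<le> node_degree G v)"
    proof (cases "v \<in> N")
      case True
      then show ?thesis using deg less.prems(1)
        by (intro exI[of _ "{x. adjacent G v x}"]) (auto simp: node_degree_neighbours)
    next
      case False
      then have "2 \<le> card {x. adjacent G v x}"
        using deg less.prems(1) by (auto simp: node_degree_neighbours)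
      then obtain A where "A \<subseteq> {x. adjacent G v x}" "card A = 2"
        using obtain_subset_with_card_n by metis
      then show ?thesis using False deg by auto
    qed
    then obtain A where A: "A \<subseteq> {x. adjacent G v x}" "card A \<ge> 2"
      "if v \<in> N then card A \<le> node_degree G v else card A + 2 \<le> node_degree G v" by blast
    \<comment> \<open>Only finitely many indices occur, so a fresh one is available at the point
      \<open>fst v\<close>.\<close>
    have "finite (snd ` nodes G)" using less.prems(1) by (simp add: simple_graph_def)
    then obtain j where "j \<notin> snd ` nodes G" using ex_new_if_finite infinite_UNIV_nat by blast
    then have w: "(fst v, j) \<notin> nodes G" by force
    define H where "H = split_graph G v (fst v, j) A"
    note split = less.prems(1) v(1) w A(1)
    have step: "split_node G H" unfolding split_node_split_graph H_def
      using split by (intro exI[of _ "fst v"] exI[of _ "snd v"] exI[of _ j] exI[of _ A]) auto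
    have H: "simple_graph H" unfolding H_def by (rule simple_split_graph[OF split])
    have nodes: "nodes H = insert (fst v, j) (nodes G)" by (simp add: H_def split_graph_def)
    have N: "N \<subseteq> nodes H" using less.prems(2) nodes by auto
    have dv: "node_degree H v + card A = node_degree G v + 1"
      unfolding H_def by (rule node_degree_split_graph_old[OF split])
    have dw: "node_degree H (fst v, j) = card A + 1"
      unfolding H_def by (rule node_degree_split_graph_new[OF split])
    have du: "node_degree H u = node_degree G u" if "u \<noteq> v" "u \<noteq> (fst v, j)" for u
      unfolding H_def by (rule node_degree_split_graph_other[OF split that])
    have d1: "\<forall>t\<in>N. node_degree H t \<ge> 1"
    proof
      fix t assume t: "t \<in> N"
      then have "t \<noteq> (fst v, j)" using w less.prems(2) by auto
      with t show "node_degree H t \<ge> 1"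
        using du[of t] dv less.prems(3) A(3) by (cases "t = v") auto
    qed
    have d3: "\<forall>u\<in>nodes H - N. node_degree H u \<ge> 3"
    proof
      fix u assume u: "u \<in> nodes H - N"
      consider "u = v" | "u = (fst v, j)" | "u \<noteq> v" "u \<noteq> (fst v, j)" by blast
      then show "node_degree H u \<ge> 3"
      proof cases
        case 1
        then show ?thesis using dv u A(3) by auto
      next
        case 2
        then show ?thesis using dw A(2) by simp
      next
        case 3
        then show ?thesis using du[OF 3] u nodes less.prems(4) by auto
      qed
    qed
    have cards: "card (edges H) = card (edges G) + 1" "card (nodes H) = card (nodes G) + 1"
      unfolding H_def by (rule card_edges_split_graph[OF split] card_nodes_split_graph[OF split])+
    \<comment> \<open>The subtraction is truncated; the bound applied to \<open>H\<close> shows that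
      the measure of \<open>G\<close> is positive and really drops.\<close>
    have "2 * card N + 2 * card (edges H) - 3 * card (nodes H)
        < 2 * card N + 2 * card (edges G) - 3 * card (nodes G)"
      using bound[OF H N d1 d3] cards by linarith
    then obtain S where "split_node\<^sup>*\<^sup>* H S" "full_topology N S"
      using less.hyps[OF _ H N d1 d3] by blast
    with step show ?thesis by (meson converse_rtranclp_into_rtranclp)
  qed
qed

lemma unsplit_map_graph: "unsplit T = map_graph (\<lambda>p. (p, 0)) T"
  by (simp add: unsplit_def map_graph_def)

text \<open>A full splitting exists, so the choice in \<open>star\<close> denotes one, and no
  splitting changes the sum of rounded lengths. Bead counts can therefore be computed on the unsplit
  tree.\<close>

lemma beads_eq:
  assumes "interconnects N T" "card N \<ge> 2"
  shows "beads N T = 1 - int (card N) + (\<Sum>e\<in>edges T. \<lceil>edge_length id e\<rceil>)"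
proof -
  let ?i = "\<lambda>p::point. (p, 0::nat)"
  have T: "simple_graph T" "connected_graph T" "N \<subseteq> nodes T" "\<forall>w\<in>nodes T - N. node_degree T w \<ge> 3"
    using assms(1) by (auto simp: interconnects_def tree_def)
  have inj: "inj_on ?i (nodes T)" by (auto simp: inj_on_def)
  have U: "simple_graph (unsplit T)" unfolding unsplit_map_graph by (rule simple_map_graph[OF T(1) inj])
  have deg: "node_degree (unsplit T) (?i p) = node_degree T p" if "p \<in> nodes T" for p
    unfolding unsplit_map_graph by (rule node_degree_map_graph[OF T(1) inj that])
  \<comment> \<open>A second terminal exists, and connectedness then gives \<open>t\<close> a
    neighbour.\<close>
  have "node_degree T t \<ge> 1" if "t \<in> N" for t
  proof -
    have "finite N" using assms(2) card.infinite by fastforce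
    then have "\<not> N \<subseteq> {t}" using assms(2) card_mono[of "{t}" N] by auto
    then obtain u where "u \<in> N" "u \<noteq> t" by blast
    then show ?thesis using node_degree_pos[OF T(1,2), of t u] T(3) that by auto
  qed
  then have "\<exists>S. split_node\<^sup>*\<^sup>* (unsplit T) S \<and> full_topology (?i ` N) S"
    using U T(3,4) deg
    by (intro exists_full_topology_splitting) (auto simp: unsplit_def subset_iff)
  then have "full_splitting N T (star N T)"
    unfolding star_def full_splitting_def by (rule someI_ex)
  then have "(\<Sum>e\<in>edges (star N T). \<lceil>edge_length fst e\<rceil>) = (\<Sum>e\<in>edges (unsplit T). \<lceil>edge_length fst e\<rceil>)"
    using split_nodes_invariant[OF _ U] unfolding full_splitting_def by blast
  also have "\<dots> = (\<Sum>e\<in>edges T. \<lceil>edge_length (fst \<circ> ?i) e\<rceil>)"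
    unfolding unsplit_map_graph by (rule sum_edges_map_graph[OF T(1) inj])
  also have "fst \<circ> ?i = id" by (simp add: fun_eq_iff)
  finally show ?thesis unfolding beads_def by (simp only:)
qed

section \<open>Pruning to an interconnecting tree\<close>

text \<open>A walk through \<open>w\<close> enters from one neighbour and leaves to another, and
  these are equal or joined in \<open>H\<close>, so the visit can be bypassed.\<close>

lemma connected_delete_node:
  assumes G: "connected_graph G" and V: "nodes H = nodes G - {w}" "nodes H \<noteq> {}"
    and E: "\<And>u v. adjacent G u v \<Longrightarrow> u \<noteq> w \<Longrightarrow> v \<noteq> w \<Longrightarrow> adjacent H u v"
    and w: "\<And>a b. adjacent G w a \<Longrightarrow> adjacent G w b \<Longrightarrow> a = b \<or> adjacent H a b"
  shows "connected_graph H"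
proof -
  \<comment> \<open>While the walk stands at \<open>w\<close>, which is absent from
    \<open>H\<close>, the invariant records that every possible next node is already reachable in
    \<open>H\<close>.\<close>
  have path: "if v = w then (\<forall>a. adjacent G w a \<longrightarrow> (adjacent H)\<^sup>*\<^sup>* u a) else (adjacent H)\<^sup>*\<^sup>* u v"
    if "(adjacent G)\<^sup>*\<^sup>* u v" "u \<noteq> w" for u v
    using that(1)
  proof (induction rule: rtranclp_induct)
    case base
    then show ?case using that(2) by simp
  next
    case (step v v')
    show ?case
    proof (cases "v' = w")
      case True
      show ?thesis
      proof (cases "v = w")
        case True
        then show ?thesis using step.IH \<open>v' = w\<close> by simp
      next
        case False
        have "(adjacent H)\<^sup>*\<^sup>* u a" if "adjacent G w a" for a
        proof -
          have "adjacent G w v" using step.hyps True by (simp add: adjacent_sym[of G w])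
          then have "v = a \<or> adjacent H v a" using w that by blast
          then show ?thesis using step.IH False by (auto intro: rtranclp.rtrancl_into_rtrancl)
        qed
        then show ?thesis using True by simp
      qed
    next
      case False
      then show ?thesis using step.IH step.hyps(2) E
        by (cases "v = w") (auto intro: rtranclp.rtrancl_into_rtrancl)
    qed
  qed
  have "(adjacent H)\<^sup>*\<^sup>* u v" if "u \<in> nodes H" "v \<in> nodes H" for u v
  proof -
    have "u \<noteq> w" "v \<noteq> w" "(adjacent G)\<^sup>*\<^sup>* u v" using that G V(1) by (auto simp: connected_graph_def)
    then show ?thesis using path[of u v] by simp
  qed
  then show ?thesis using V(2) by (simp add: connected_graph_def)
qed

text \<open>Additional nodes of degree below three are removed one at a time: a leaf goes together
  with its edge, and a node of degree two is replaced by the straight segment between its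
  neighbours. Neither operation raises the sum of rounded lengths.\<close>

lemma exists_interconnecting_tree:
  fixes G :: "point graph"
  assumes "simple_graph G" "connected_graph G" "card (edges G) < card (nodes G)" "N \<subseteq> nodes G"
    "card N \<ge> 2"
  shows "\<exists>T. interconnects N T \<and>
    (\<Sum>e\<in>edges T. \<lceil>edge_length id e\<rceil>) \<le> (\<Sum>e\<in>edges G. \<lceil>edge_length id e\<rceil>)"
  using assms(1-4)
proof (induction "card (nodes G)" arbitrary: G rule: less_induct)
  case less
  note G = less.prems
  let ?c = "\<lambda>e. \<lceil>edge_length id e\<rceil>"
  show ?case
  proof (cases "\<forall>w\<in>nodes G - N. node_degree G w \<ge> 3")
    case True
    then show ?thesis using G acyclic_graph_if_few_edges[OF G(1-3)]
      by (intro exI[of _ G]) (simp add: interconnects_def tree_def)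
  next
    case False
    then obtain w where w: "w \<in> nodes G" "w \<notin> N" "node_degree G w < 3" by force
    have fin: "finite (nodes G)" "finite (edges G)"
      using G(1) edges_finite by (auto simp: simple_graph_def)
    obtain t where t: "t \<in> N" using assms(5) by fastforce
    then have "node_degree G w \<ge> 1"
      using node_degree_pos[OF G(1,2) w(1), of t] w(2) G(4) by blast
    then have "card {x. adjacent G w x} = 1 \<or> card {x. adjacent G w x} = 2"
      using w(3) G(1) by (auto simp: node_degree_neighbours)
    \<comment> \<open>Both degrees are treated together: \<open>a = b\<close> is the case of degree
      one.\<close>
    then obtain a b where ab: "{x. adjacent G w x} = {a, b}"
      by (metis card_1_singletonE card_2_iff insert_absorb2)
    have a: "adjacent G w a" and b: "adjacent G w b" using ab by auto
    have ne: "w \<noteq> a" "w \<noteq> b" "a \<in> nodes G" "b \<in> nodes G"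
      using adjacent_nodes[OF G(1) a] adjacent_nodes[OF G(1) b] by auto
    define E where "E = {e \<in> edges G. w \<notin> e}"
    define H where "H = \<lparr>nodes = nodes G - {w}, edges = E \<union> (if a = b then {} else {{a, b}})\<rparr>"
    have finE: "finite E" unfolding E_def using fin by simp
    have "{e \<in> edges G. w \<in> e} = {{w, a}, {w, b}}"
    proof (intro set_eqI iffI)
      fix e assume e: "e \<in> {e \<in> edges G. w \<in> e}"
      then obtain u v where "e = {u, v}" using G(1) by (blast elim: edgeE)
      then have "\<exists>x. e = {w, x}" using e by blast
      then obtain x where x: "e = {w, x}" by blast
      with e have "x \<in> {x. adjacent G w x}" by (simp add: adjacent_def)
      then show "e \<in> {{w, a}, {w, b}}" unfolding ab using x by auto
    qed (use a b in \<open>auto simp: adjacent_def\<close>)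
    then have edges: "edges G = E \<union> {{w, a}, {w, b}}" unfolding E_def by blast
    have sumG: "(\<Sum>e\<in>edges G. h e) = (\<Sum>e\<in>E. h e) + (if a = b then h {w, a} else h {w, a} + h {w, b})"
      for h :: "point set \<Rightarrow> int"
    proof -
      have "(\<Sum>e\<in>edges G. h e) = (\<Sum>e\<in>E. h e) + (\<Sum>e\<in>{{w, a}, {w, b}}. h e)"
        unfolding edges using finE by (intro sum.union_disjoint) (auto simp: E_def)
      then show ?thesis by (simp add: doubleton_eq_iff)
    qed
    \<comment> \<open>Only an inequality, since the segment \<open>{a, b}\<close> could already
      belong to \<open>E\<close> and is then counted once.\<close>
    have sumH: "(\<Sum>e\<in>edges H. h e) \<le> (\<Sum>e\<in>E. h e) + (if a = b then 0 else h {a, b})"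
      if "h {a, b} \<ge> 0" for h :: "point set \<Rightarrow> int"
      using finE that by (simp add: H_def sum.insert_if)
    have H1: "simple_graph H"
    proof -
      have "E \<subseteq> {{u, v} |u v. u \<in> nodes G - {w} \<and> v \<in> nodes G - {w} \<and> u \<noteq> v}"
      proof
        fix e assume "e \<in> E"
        then have e: "e \<in> edges G" "w \<notin> e" by (auto simp: E_def)
        obtain u v where "e = {u, v}" "u \<in> nodes G" "v \<in> nodes G" "u \<noteq> v"
          using G(1) e(1) by (rule edgeE)
        with e(2) show "e \<in> {{u, v} |u v. u \<in> nodes G - {w} \<and> v \<in> nodes G - {w} \<and> u \<noteq> v}" by blast
      qed
      moreover have "a = b \<or> {a, b} \<in> {{u, v} |u v. u \<in> nodes G - {w} \<and> v \<in> nodes G - {w} \<and> u \<noteq> v}"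
        using ne by blast
      ultimately show ?thesis using fin(1) by (auto simp: simple_graph_def H_def)
    qed
    have adjH: "adjacent H u v" if "adjacent G u v" "u \<noteq> w" "v \<noteq> w" for u v
      using that by (auto simp: adjacent_def H_def E_def)
    have N: "N \<subseteq> nodes H" using w(2) G(4) by (auto simp: H_def)
    have H2: "connected_graph H"
    proof (rule connected_delete_node[OF G(2)])
      show "nodes H = nodes G - {w}" by (simp add: H_def)
      show "nodes H \<noteq> {}" using N t by blast
      show "adjacent H u v" if "adjacent G u v" "u \<noteq> w" "v \<noteq> w" for u v
        by (rule adjH[OF that])
      show "x = y \<or> adjacent H x y" if "adjacent G w x" "adjacent G w y" for x y
      proof -
        have "x \<in> {a, b}" "y \<in> {a, b}" using that unfolding ab[symmetric] by auto
        then show ?thesis by (auto simp: adjacent_def H_def insert_commute)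
      qed
    qed
    have cardH: "card (nodes H) + 1 = card (nodes G)"
      using card_Suc_Diff1[OF fin(1) w(1)] by (simp add: H_def)
    \<comment> \<open>With constant weight 1 the two sums count edges, so at least one edge
      disappears along with the node.\<close>
    have "int (card (edges H)) < int (card (edges G))"
      using sumG[of "\<lambda>_. 1"] sumH[of "\<lambda>_. 1"] by (auto split: if_splits)
    then have H3: "card (edges H) < card (nodes H)" using cardH G(3) by linarith
    obtain T where T: "interconnects N T" "(\<Sum>e\<in>edges T. ?c e) \<le> (\<Sum>e\<in>edges H. ?c e)"
      using less.hyps[of H, OF _ H1 H2 H3 N] cardH by auto
    \<comment> \<open>The ceiling is monotone and subadditive, so the triangle inequality survives
      rounding.\<close>
    have "dist a b \<le> dist w a + dist w b" by (metis dist_commute dist_triangle)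
    then have "\<lceil>dist a b\<rceil> \<le> \<lceil>dist w a\<rceil> + \<lceil>dist w b\<rceil>" by linarith
    then have "(if a = b then 0 else ?c {a, b}) \<le> (if a = b then ?c {w, a} else ?c {w, a} + ?c {w, b})"
      by (simp add: edge_length_doubleton order_less_le_trans[OF _ zero_le_dist])
    moreover have "?c {a, b} \<ge> 0"
      by (simp add: edge_length_doubleton order_less_le_trans[OF _ zero_le_dist])
    ultimately have "(\<Sum>e\<in>edges H. ?c e) \<le> (\<Sum>e\<in>edges G. ?c e)"
      using sumG[of ?c] sumH[of ?c] by linarith
    with T show ?thesis by (meson order_trans)
  qed
qed

section \<open>Moving the Steiner points of a full MSPT\<close>

text \<open>Coinciding nodes leave an image graph with fewer nodes, so a spanning tree of it has
  fewer edges than \<open>T\<close>. Charging each of its edges to a preimage in \<open>T\<close>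
  leaves some edge of \<open>T\<close> uncharged, and the positive weight of that edge is saved.
  Pruning does not lose the saving.\<close>

lemma exists_interconnecting_tree_if_not_inj:
  fixes pos :: "point \<Rightarrow> point" and k :: "point set \<Rightarrow> int"
  assumes T: "tree T" "N \<subseteq> nodes T" "card N \<ge> 2"
    and pos: "\<forall>t\<in>N. pos t = t" "\<forall>e\<in>edges T. \<lceil>edge_length pos e\<rceil> \<le> k e"
    and k: "\<forall>e\<in>edges T. k e > 0"
    and not_inj: "\<not> inj_on pos (nodes T)"
  shows "\<exists>T'. interconnects N T' \<and>
    (\<Sum>e\<in>edges T'. \<lceil>edge_length id e\<rceil>) < (\<Sum>e\<in>edges T. k e)"
proof -
  have S: "simple_graph T" "connected_graph T" and fin: "finite (nodes T)" "finite (edges T)"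
    using T(1) edges_finite by (auto simp: tree_def simple_graph_def)
  let ?I = "(\<lambda>e. pos ` e) ` edges T"
  \<comment> \<open>Edges whose ends coincide under \<open>pos\<close> are discarded.\<close>
  define G where "G = \<lparr>nodes = pos ` nodes T, edges = {e \<in> ?I. \<exists>u v. e = {u, v} \<and> u \<noteq> v}\<rparr>"
  have "e \<in> {{u, v} |u v. u \<in> nodes G \<and> v \<in> nodes G \<and> u \<noteq> v}" if e: "e \<in> edges G" for e
  proof -
    obtain u v where uv: "e = {u, v}" "u \<noteq> v" using e unfolding G_def by auto
    have "e \<subseteq> nodes G" using e edges_subset_Pow[OF S(1)] unfolding G_def by auto
    then show ?thesis using uv by blast
  qed
  moreover have "finite (nodes G)" using fin(1) by (simp add: G_def)
  ultimately have G1: "simple_graph G" unfolding simple_graph_def by blast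
  have adj: "pos u = pos v \<or> adjacent G (pos u) (pos v)" if "adjacent T u v" for u v
    using imageI[OF that[unfolded adjacent_def], of "image pos"]
    by (auto simp: G_def adjacent_def)
  have G2: "connected_graph G"
    using S(2) by (rule connected_map_graph[of _ _ pos]) (use adj in \<open>auto simp: G_def\<close>)
  obtain H where H: "simple_graph H" "connected_graph H" "nodes H = nodes G" "edges H \<subseteq> edges G"
    "card (edges H) + 1 = card (nodes H)"
    by (rule spanning_tree[OF G1 G2])
  have "N \<subseteq> nodes H"
  proof
    fix t assume "t \<in> N"
    then have t: "pos t \<in> pos ` nodes T" "pos t = t" using T(2) pos(1) by blast+
    show "t \<in> nodes H" using t(1) unfolding H(3) G_def t(2) by simp
  qed
  then obtain T' where T': "interconnects N T'"
    "(\<Sum>e\<in>edges T'. \<lceil>edge_length id e\<rceil>) \<le> (\<Sum>e\<in>edges H. \<lceil>edge_length id e\<rceil>)"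
    using exists_interconnecting_tree[OF H(1,2) _ _ T(3)] H(5) by auto
  have "\<forall>e\<in>edges H. \<exists>e'\<in>edges T. pos ` e' = e"
  proof
    fix e assume "e \<in> edges H"
    with H(4) have "e \<in> edges G" by blast
    then show "\<exists>e'\<in>edges T. pos ` e' = e" by (auto simp: G_def)
  qed
  \<comment> \<open>The map \<open>g\<close> charges each spanning-tree edge to one of its
    preimages; it is injective because the image of \<open>g e\<close> under \<open>pos\<close>
    recovers \<open>e\<close>.\<close>
  then obtain g where g: "\<And>e. e \<in> edges H \<Longrightarrow> g e \<in> edges T \<and> pos ` g e = e" by metis
  have inj: "inj_on g (edges H)" using g by (metis inj_onI)
  have "card (nodes H) < card (nodes T)"
    unfolding H(3) G_def
    using card_image_le[OF fin(1), of pos] eq_card_imp_inj_on[OF fin(1), of pos] not_inj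
    by (auto simp: less_le)
  then have "card (g ` edges H) < card (edges T)"
    using H(5) card_edges_tree[OF T(1)] card_image[OF inj] by simp
  then have "g ` edges H \<noteq> edges T" by auto
  moreover have sub: "g ` edges H \<subseteq> edges T" using g by auto
  ultimately obtain f where f: "f \<in> edges T - g ` edges H" by blast
  have "(\<Sum>e\<in>edges H. \<lceil>edge_length id e\<rceil>) \<le> (\<Sum>e\<in>edges H. k (g e))"
  proof (rule sum_mono)
    fix e assume e: "e \<in> edges H"
    have "edge_length id (pos ` g e) = edge_length (id \<circ> pos) (g e)"
      using g[OF e] by (intro edge_length_image[OF S(1)]) simp
    then have "edge_length id e = edge_length pos (g e)" using g[OF e] by simp
    then show "\<lceil>edge_length id e\<rceil> \<le> k (g e)" using pos(2) g[OF e] by simp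
  qed
  also have "\<dots> = (\<Sum>e\<in>g ` edges H. k e)" by (simp add: sum.reindex[OF inj])
  also have "\<dots> < (\<Sum>e\<in>edges T. k e)"
    using k f sub fin(2) by (intro sum_strict_mono2[of _ _ f]) (auto simp: less_imp_le)
  finally show ?thesis using T' by (meson le_less_trans)
qed

lemma ceiling_edge_length_pos:
  assumes "simple_graph T" "e \<in> edges T"
  shows "\<lceil>edge_length id e\<rceil> > 0"
  using assms by (rule edgeE) (simp add: edge_length_doubleton)

text \<open>Since \<open>\<lceil>edge_length id e\<rceil>\<close> is an integer, the bound on the
  moved edge also bounds its rounded length, so the bead count cannot rise. Coinciding nodes would
  even lower it, contradicting minimality.\<close>

lemma full_MSPT_moved:
  assumes T: "full_MSPT N T"
    and pos: "\<forall>t\<in>N. pos t = t" "\<forall>e\<in>edges T. edge_length pos e \<le> \<lceil>edge_length id e\<rceil>"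
  shows "inj_on pos (nodes T)" "full_MSPT N (map_graph pos T)" "same_topology N T (map_graph pos T)"
proof -
  have M: "interconnects N T" "full_topology N T" "\<And>T'. interconnects N T' \<Longrightarrow> beads N T \<le> beads N T'"
    using T by (auto simp: full_MSPT_def MSPT_def)
  have S: "tree T" "simple_graph T" "N \<subseteq> nodes T"
    using M(1) by (auto simp: interconnects_def tree_def)
  note n = full_topology_card(2)[OF S(1,3) M(2)]
  have le: "\<forall>e\<in>edges T. \<lceil>edge_length pos e\<rceil> \<le> \<lceil>edge_length id e\<rceil>"
    using pos(2) by (simp add: ceiling_le_iff)
  show inj: "inj_on pos (nodes T)"
  proof (rule ccontr)
    assume "\<not> inj_on pos (nodes T)"
    then obtain T' where "interconnects N T'"
      "(\<Sum>e\<in>edges T'. \<lceil>edge_length id e\<rceil>) < (\<Sum>e\<in>edges T. \<lceil>edge_length id e\<rceil>)"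
      using exists_interconnecting_tree_if_not_inj[OF S(1,3) n pos(1) le] ceiling_edge_length_pos[OF S(2)]
      by blast
    then show False using M(3)[of T'] beads_eq[OF _ n] M(1) by fastforce
  qed
  have posN: "pos ` N = N" using pos(1) by simp
  have full: "full_topology N (map_graph pos T)"
    using full_topology_map_graph[OF S(2) inj S(3)] M(2) posN by simp
  have "N \<subseteq> nodes (map_graph pos T)" using image_mono[OF S(3), of pos] posN unfolding map_graph_def by simp
  then have int: "interconnects N (map_graph pos T)"
    using tree_map_graph[OF S(1) inj] full unfolding interconnects_def full_topology_def by simp
  have "(\<Sum>e\<in>edges (map_graph pos T). \<lceil>edge_length id e\<rceil>) = (\<Sum>e\<in>edges T. \<lceil>edge_length pos e\<rceil>)"
    using sum_edges_map_graph[OF S(2) inj, of ceiling id] by simp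
  also have "\<dots> \<le> (\<Sum>e\<in>edges T. \<lceil>edge_length id e\<rceil>)" using le by (intro sum_mono) auto
  finally have "beads N (map_graph pos T) \<le> beads N T" using beads_eq[OF _ n] int M(1) by simp
  then have "beads N (map_graph pos T) \<le> beads N T'" if "interconnects N T'" for T'
    using M(3)[OF that] by simp
  then show "full_MSPT N (map_graph pos T)" using int full by (simp add: full_MSPT_def MSPT_def)
  show "same_topology N T (map_graph pos T)"
    unfolding same_topology_def using inj pos(1)
    by (intro exI[of _ pos]) (auto simp: map_graph_def bij_betw_def)
qed

section \<open>Contracting all edges but one\<close>

text \<open>Cramer's rule: the determinant \<open>D\<close> of the two edge directions is nonzero
  when the three points are not collinear.\<close>

lemma exists_inner_eq_2D:
  fixes a b c :: point
  assumes "\<not> collinear {a, b, c}"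
  shows "\<exists>y. (a - b) \<bullet> y = \<beta> \<and> (a - c) \<bullet> y = \<gamma>"
proof -
  define u w where "u = b - a" and "w = c - a"
  define D where "D = u $ 1 * w $ 2 - u $ 2 * w $ 1"
  have "D \<noteq> 0"
  proof
    assume D: "D = 0"
    have "collinear {0, u, w}"
    proof (cases "u = 0")
      case False
      then have pos: "u \<bullet> u \<noteq> 0" by simp
      \<comment> \<open>The difference between \<open>(u \<bullet> u) w\<close> and
        \<open>(u \<bullet> w) u\<close> is \<open>D\<close> times \<open>u\<close> turned by a
        right angle, so for \<open>D = 0\<close> the vector \<open>w\<close> equals its projection
        onto \<open>u\<close>.\<close>
      have "w = ((u \<bullet> w) / (u \<bullet> u)) *\<^sub>R u"
      proof -
        have "(u \<bullet> u) * w $ i = (u \<bullet> w) * u $ i" for i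
        proof -
          have "i = 1 \<or> i = 2" using exhaust_2 by blast
          moreover have "(u $ 1 * u $ 1 + u $ 2 * u $ 2) * w $ 1 - (u $ 1 * w $ 1 + u $ 2 * w $ 2) * u $ 1 = - u $ 2 * D"
            "(u $ 1 * u $ 1 + u $ 2 * u $ 2) * w $ 2 - (u $ 1 * w $ 1 + u $ 2 * w $ 2) * u $ 2 = u $ 1 * D"
            unfolding D_def by algebra+
          ultimately show ?thesis using D by (auto simp: inner_vec_def sum_2)
        qed
        then show ?thesis using pos by (simp add: vec_eq_iff field_simps)
      qed
      then show ?thesis unfolding collinear_lemma by blast
    qed simp
    then have "collinear {b, a, c}" unfolding u_def w_def by (subst collinear_3) auto
    with assms show False by (simp add: insert_commute)
  qed
  \<comment> \<open>The solution of \<open>u \<bullet> y = - \<beta>\<close>,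
    \<open>w \<bullet> y = - \<gamma>\<close>; the signs arise because \<open>u\<close> and
    \<open>w\<close> point away from \<open>a\<close>.\<close>
  define y :: point where
    "y = vector [(\<gamma> * u $ 2 - \<beta> * w $ 2) / D, (\<beta> * w $ 1 - \<gamma> * u $ 1) / D]"
  have "u \<bullet> y = (u $ 1 * (\<gamma> * u $ 2 - \<beta> * w $ 2) + u $ 2 * (\<beta> * w $ 1 - \<gamma> * u $ 1)) / D"
    by (simp add: inner_vec_def sum_2 y_def add_divide_distrib)
  also have "u $ 1 * (\<gamma> * u $ 2 - \<beta> * w $ 2) + u $ 2 * (\<beta> * w $ 1 - \<gamma> * u $ 1) = - \<beta> * D"
    unfolding D_def by algebra
  finally have "u \<bullet> y = - \<beta>" using \<open>D \<noteq> 0\<close> by simp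
  moreover have "w \<bullet> y = (w $ 1 * (\<gamma> * u $ 2 - \<beta> * w $ 2) + w $ 2 * (\<beta> * w $ 1 - \<gamma> * u $ 1)) / D"
    by (simp add: inner_vec_def sum_2 y_def add_divide_distrib)
  moreover have "w $ 1 * (\<gamma> * u $ 2 - \<beta> * w $ 2) + w $ 2 * (\<beta> * w $ 1 - \<gamma> * u $ 1) = - \<gamma> * D"
    unfolding D_def by algebra
  ultimately have "u \<bullet> y = - \<beta>" "w \<bullet> y = - \<gamma>" using \<open>D \<noteq> 0\<close> by simp_all
  then show ?thesis by (intro exI[of _ y]) (simp add: u_def w_def inner_diff_left)
qed

text \<open>Root the tree at an endpoint of \<open>e0\<close>. Apart from \<open>e0\<close>, every Steiner point has exactly two
  edges to its children and every terminal has none, so the velocities \<open>h\<close> can be chosen from the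
  deepest nodes upwards.\<close>

lemma exists_contracting_velocities:
  fixes x :: "'v \<Rightarrow> point"
  assumes G: "tree G" and N: "N \<subseteq> nodes G" "full_topology N G" and e0: "e0 \<in> edges G"
    and no_bond: "\<And>s a b. s \<in> nodes G - N \<Longrightarrow> adjacent G s a \<Longrightarrow> adjacent G s b \<Longrightarrow> a \<noteq> b
      \<Longrightarrow> \<not> collinear {x s, x a, x b}"
  shows "\<exists>h. (\<forall>t\<in>N. h t = 0) \<and>
    (\<forall>u v. {u, v} \<in> edges G - {e0} \<longrightarrow> (x u - x v) \<bullet> (h u - h v) = - 1)"
proof -
  have S: "simple_graph G" and fin: "finite (nodes G)" using G by (auto simp: tree_def simple_graph_def)
  obtain r b where rb: "e0 = {r, b}" "r \<in> nodes G" "b \<in> nodes G" "r \<noteq> b" "adjacent G r b"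
    using S e0 by (rule edgeE)
  obtain p and d :: "'v \<Rightarrow> nat"
    where pd: "\<forall>v\<in>nodes G - {r}. p v \<in> nodes G \<and> d v = Suc (d (p v))"
      and E: "edges G = (\<lambda>v. {p v, v}) ` (nodes G - {r})"
    by (rule tree_parents[OF G rb(2)])
  \<comment> \<open>\<open>Q v\<close> holds the children of \<open>v\<close> not reached through
    \<open>e0\<close>, and \<open>s v\<close> is the one remaining neighbour: the parent, or at the
    root the other end of \<open>e0\<close>.\<close>
  define Q where "Q v = {c \<in> nodes G - {r}. p c = v \<and> {p c, c} \<noteq> e0}" for v
  define s where "s v = (if v = r then b else p v)" for v
  have b: "p b = r"
  proof -
    obtain v where v: "v \<in> nodes G - {r}" "{r, b} = {p v, v}" using e0 E rb(1) by auto
    then have "v = b \<and> p v = r" using rb(4) by (auto simp: doubleton_eq_iff)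
    then show ?thesis by blast
  qed
  have pv: "{p v, v} \<noteq> e0" if "v \<in> nodes G - {r}" "v \<noteq> b" for v
    using that rb by (auto simp: doubleton_eq_iff)
  have adj: "adjacent G u v \<longleftrightarrow> (v \<in> nodes G - {r} \<and> p v = u) \<or> (u \<in> nodes G - {r} \<and> p u = v)" for u v
    unfolding adjacent_def E by (auto simp: doubleton_eq_iff)
  have dQ: "d c = Suc (d v)" "c \<in> nodes G" "adjacent G v c" if "c \<in> Q v" for c v
    using that pd adj unfolding Q_def by auto
  have nbrs: "{u. adjacent G v u} = insert (s v) (Q v)" "s v \<notin> Q v" if v: "v \<in> nodes G" for v
  proof -
    show "{u. adjacent G v u} = insert (s v) (Q v)"
    proof (cases "v = r")
      case True
      then show ?thesis using rb b pv unfolding adj Q_def s_def by auto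
    next
      case False
      have "{p c, c} \<noteq> e0" if "c \<in> nodes G - {r}" "p c = v" for c
        using that False b by (intro pv) auto
      then show ?thesis using v False unfolding adj Q_def s_def by auto
    qed
    show "s v \<notin> Q v"
    proof (cases "v = r")
      case True
      then show ?thesis using rb b by (auto simp: Q_def s_def)
    next
      case False
      then show ?thesis using pd v dQ(1)[of "p v" v] by (auto simp: s_def)
    qed
  qed
  have finQ: "finite (Q v)" for v unfolding Q_def using fin by simp
  have deg: "node_degree G v = Suc (card (Q v))" if "v \<in> nodes G" for v
    using nbrs[OF that] finQ by (simp add: node_degree_neighbours[OF S])
  have QN: "Q t = {}" if "t \<in> N" for t
  proof -
    have "card (Q t) = 0" using deg[of t] that N by (auto simp: full_topology_def)
    then show ?thesis using finQ by simp
  qed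
  \<comment> \<open>A Steiner point has two such children, not collinear with it, so their two
    equations determine a velocity.\<close>
  have solve: "\<exists>y. \<forall>c\<in>Q v. (x v - x c) \<bullet> y = \<alpha> c" if v: "v \<in> nodes G - N" for v \<alpha>
  proof -
    have "card (Q v) = 2" using deg[of v] v N by (auto simp: full_topology_def)
    then obtain c c' where c: "Q v = {c, c'}" "c \<noteq> c'" by (auto simp: card_2_iff)
    then have "\<not> collinear {x v, x c, x c'}" using no_bond[OF v _ _ c(2)] dQ(3)[of _ v] by simp
    then obtain y where "(x v - x c) \<bullet> y = \<alpha> c" "(x v - x c') \<bullet> y = \<alpha> c'"
      using exists_inner_eq_2D by metis
    then show ?thesis using c(1) by (intro exI[of _ y]) simp
  qed
  \<comment> \<open>\<open>K\<close> exceeds every depth, so the induction below starts vacuously at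
    \<open>j = 0\<close> and covers all nodes at \<open>j = K\<close>.\<close>
  define K where "K = Suc (Max (d ` nodes G))"
  have "\<exists>h. (\<forall>t\<in>N. h t = 0) \<and>
    (\<forall>v\<in>nodes G. K \<le> d v + j \<longrightarrow> (\<forall>c\<in>Q v. (x v - x c) \<bullet> (h v - h c) = - 1))" for j
  proof (induction j)
    case 0
    have "d v < K" if "v \<in> nodes G" for v
      unfolding K_def using fin that by (simp add: le_imp_less_Suc)
    then show ?case by (intro exI[of _ "\<lambda>_. 0"]) (auto simp: not_le[symmetric])
  next
    case (Suc j)
    then obtain h where h: "\<forall>t\<in>N. h t = 0"
      "\<And>v c. v \<in> nodes G \<Longrightarrow> K \<le> d v + j \<Longrightarrow> c \<in> Q v \<Longrightarrow> (x v - x c) \<bullet> (h v - h c) = - 1" by blast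
    have "\<exists>y. \<forall>c\<in>Q v. (x v - x c) \<bullet> y = (x v - x c) \<bullet> h c - 1" if "v \<in> nodes G - N" for v
      using solve[OF that, of "\<lambda>c. (x v - x c) \<bullet> h c - 1"] .
    then obtain y where y: "\<And>v c. v \<in> nodes G - N \<Longrightarrow> c \<in> Q v \<Longrightarrow>
        (x v - x c) \<bullet> y v = (x v - x c) \<bullet> h c - 1"
      by metis
    \<comment> \<open>Only the level of depth \<open>K - Suc j\<close> is changed. Children lie one
      level deeper, so their velocities are already final.\<close>
    define h' where "h' v = (if v \<in> nodes G - N \<and> d v + Suc j = K then y v else h v)" for v
    have "(x v - x c) \<bullet> (h' v - h' c) = - 1" if v: "v \<in> nodes G" "K \<le> d v + Suc j" "c \<in> Q v" for v c
    proof -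
      have "h' c = h c" using v dQ[OF v(3)] by (simp add: h'_def)
      moreover have "v \<notin> N" using QN v(3) by blast
      ultimately show ?thesis
        using v y[of v c] h(2)[of v c] by (auto simp: h'_def inner_diff_right)
    qed
    moreover have "\<forall>t\<in>N. h' t = 0" using h(1) by (simp add: h'_def)
    ultimately show ?case by blast
  qed
  from this[of K] obtain h where h: "\<forall>t\<in>N. h t = 0"
    "\<And>v c. v \<in> nodes G \<Longrightarrow> c \<in> Q v \<Longrightarrow> (x v - x c) \<bullet> (h v - h c) = - 1" by auto
  have "(x u - x v) \<bullet> (h u - h v) = - 1" if uv: "{u, v} \<in> edges G - {e0}" for u v
  proof -
    obtain c where c: "c \<in> nodes G - {r}" "{u, v} = {p c, c}" using uv E by auto
    then have "c \<in> Q (p c)" using uv by (auto simp: Q_def)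
    then have "(x (p c) - x c) \<bullet> (h (p c) - h c) = - 1" using h(2) c(1) pd by blast
    moreover have "(x c - x (p c)) \<bullet> (h c - h (p c)) = (x (p c) - x c) \<bullet> (h (p c) - h c)"
      by (metis inner_minus_left inner_minus_right minus_diff_eq minus_minus)
    ultimately show ?thesis using c(2) by (auto simp: doubleton_eq_iff)
  qed
  with h(1) show ?thesis by blast
qed

text \<open>\<open>a \<bullet> b\<close> is half the derivative at 0 of the squared norm of
  \<open>a + t *\<^sub>R b\<close>. With \<open>a\<close> the difference of two positions and
  \<open>b\<close> that of their velocities, this turns the velocity condition into a shrinking
  edge.\<close>

lemma eventually_norm_decreases:
  fixes a b :: "'a::real_inner"
  assumes "a \<bullet> b = - 1"
  shows "\<forall>\<^sub>F t in at_right 0. norm (a + t *\<^sub>R b) < norm a"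
proof -
  \<comment> \<open>The squared norm changes by \<open>t\<close> times
    \<open>t * (b \<bullet> b) - 2\<close>, so \<open>t * (b \<bullet> b) < 2\<close> is wanted; the
    summand 1 makes the denominator visibly positive.\<close>
  define c where "c = 2 / (b \<bullet> b + 1)"
  have "b \<bullet> b + 1 > 0" using inner_ge_zero[of b] by linarith
  then have "c > 0" unfolding c_def by simp
  have c: "c * (b \<bullet> b + 1) = 2" using \<open>b \<bullet> b + 1 > 0\<close> unfolding c_def
    by (intro nonzero_eq_divide_eq[THEN iffD1]) auto
  have "norm (a + t *\<^sub>R b) < norm a" if t: "0 < t" "t < c" for t
  proof -
    have "t * (b \<bullet> b) \<le> t * (b \<bullet> b + 1)" using t by (simp add: algebra_simps)
    also have "\<dots> < c * (b \<bullet> b + 1)" using t(2) \<open>b \<bullet> b + 1 > 0\<close> by (intro mult_strict_right_mono)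
    finally have "t * (b \<bullet> b) < 2" using c by simp
    then have "t * (t * (b \<bullet> b)) < t * 2" using t by simp
    moreover have "(norm (a + t *\<^sub>R b))\<^sup>2 = a \<bullet> a + 2 * t * (a \<bullet> b) + t * (t * (b \<bullet> b))"
      unfolding power2_norm_eq_inner by (simp add: inner_add_left inner_add_right inner_commute algebra_simps)
    ultimately have "(norm (a + t *\<^sub>R b))\<^sup>2 < (norm a)\<^sup>2"
      using assms by (simp add: power2_norm_eq_inner)
    then show ?thesis by (rule power2_less_imp_less) simp
  qed
  then show ?thesis unfolding eventually_at_right_field using \<open>c > 0\<close> by blast
qed

section \<open>A packed MSPT\<close>

text \<open>Tychonoff's theorem, carried over to the topology on the function type.\<close>

lemma compact_PiE_UNIV:
  fixes S :: "'i \<Rightarrow> 'b::topological_space set"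
  assumes "\<And>i. compact (S i)"
  shows "compact (PiE UNIV S)"
  using assms compactin_PiE[of "\<lambda>_. euclidean" UNIV S] by (simp add: euclidean_product_topology)

lemma continuous_on_edge_length:
  assumes "simple_graph G" "e \<in> edges G"
  shows "continuous_on UNIV (\<lambda>pos. edge_length pos e)"
  using assms
  by (rule edgeE) (simp add: edge_length_doubleton continuous_on_dist continuous_on_product_coordinates)

lemma exists_Z_packed_MSPT:
  assumes T: "full_MSPT N T" "bond_free N T"
  shows "\<exists>T'. MSPT N T' \<and> Z_packed N T'"
proof -
  let ?k = "\<lambda>e. real_of_int \<lceil>edge_length id e\<rceil>"
  have M: "interconnects N T" "full_topology N T" using T by (auto simp: full_MSPT_def MSPT_def)
  have S: "tree T" "simple_graph T" "connected_graph T" "N \<subseteq> nodes T"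
    using M(1) by (auto simp: interconnects_def tree_def)
  have fin: "finite (nodes T)" "finite (edges T)" using S(2) edges_finite by (auto simp: simple_graph_def)
  note cards = full_topology_card[OF S(1,4) M(2)]
  obtain t where t: "t \<in> N" using cards(2) by fastforce
  have "card (edges T) \<ge> 1" using cards by linarith
  then have "edges T \<noteq> {}" by auto
  then obtain f where f: "f \<in> edges T" by blast

  \<comment> \<open>Adding the length bounds along a path from the fixed terminal \<open>t\<close>
    bounds the position of every node uniformly over all admissible placements.\<close>
  have "\<exists>B. \<forall>pos. (\<forall>t\<in>N. pos t = t) \<longrightarrow> (\<forall>e\<in>edges T. edge_length pos e \<le> ?k e) \<longrightarrow> dist t (pos v) \<le> B"
    if "(adjacent T)\<^sup>*\<^sup>* t v" for v
    using that
  proof (induction rule: rtranclp_induct)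
    case base
    then show ?case using t by (intro exI[of _ 0]) simp
  next
    case (step u v)
    then obtain B where B: "\<And>pos. \<forall>t\<in>N. pos t = t \<Longrightarrow> \<forall>e\<in>edges T. edge_length pos e \<le> ?k e
      \<Longrightarrow> dist t (pos u) \<le> B" by blast
    show ?case
    proof (intro exI[of _ "B + ?k {u, v}"] allI impI)
      fix pos assume pos: "\<forall>t\<in>N. pos t = t" "\<forall>e\<in>edges T. edge_length pos e \<le> ?k e"
      have "edge_length pos {u, v} \<le> ?k {u, v}" using pos(2) step.hyps(2) by (simp add: adjacent_def)
      then have "dist (pos u) (pos v) \<le> ?k {u, v}" by (simp only: edge_length_doubleton)
      then show "dist t (pos v) \<le> B + ?k {u, v}"
        using B[OF pos] dist_triangle[of t "pos v" "pos u"] by linarith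
    qed
  qed
  then have "\<forall>v\<in>nodes T. \<exists>B. \<forall>pos. (\<forall>t\<in>N. pos t = t) \<longrightarrow> (\<forall>e\<in>edges T. edge_length pos e \<le> ?k e)
      \<longrightarrow> dist t (pos v) \<le> B"
    using S(3,4) t by (simp add: connected_graph_def subset_iff)
  then obtain B where B: "\<And>v pos. v \<in> nodes T \<Longrightarrow> \<forall>t\<in>N. pos t = t \<Longrightarrow>
      \<forall>e\<in>edges T. edge_length pos e \<le> ?k e \<Longrightarrow> dist t (pos v) \<le> B v"
    by metis

  \<comment> \<open>Placements are functions on the whole plane. Pinning every point that is not a
    Steiner point leaves a product of balls and singletons, which is compact.\<close>
  define K where "K = PiE UNIV (\<lambda>v. if v \<in> nodes T - N then cball t (B v) else {v})"
  define C where "C = K \<inter> (\<Inter>e\<in>edges T. {pos. edge_length pos e \<le> ?k e})"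
  \<comment> \<open>The balls disappear from the description, because the edge bounds already imply
    them.\<close>
  have C_iff: "pos \<in> C \<longleftrightarrow> (\<forall>v. v \<notin> nodes T - N \<longrightarrow> pos v = v) \<and> (\<forall>e\<in>edges T. edge_length pos e \<le> ?k e)"
    for pos
  proof
    assume "pos \<in> C"
    then show "(\<forall>v. v \<notin> nodes T - N \<longrightarrow> pos v = v) \<and> (\<forall>e\<in>edges T. edge_length pos e \<le> ?k e)"
      by (auto simp: C_def K_def PiE_iff split: if_splits)
  next
    assume pos: "(\<forall>v. v \<notin> nodes T - N \<longrightarrow> pos v = v) \<and> (\<forall>e\<in>edges T. edge_length pos e \<le> ?k e)"
    then have "dist t (pos v) \<le> B v" if "v \<in> nodes T" for v using B[OF that, of pos] by simp
    with pos show "pos \<in> C" by (simp add: C_def K_def PiE_iff)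
  qed
  have "compact C" unfolding C_def
  proof (rule compact_Int_closed)
    show "compact K" unfolding K_def by (rule compact_PiE_UNIV) simp
    show "closed (\<Inter>e\<in>edges T. {pos. edge_length pos e \<le> ?k e})"
      using continuous_on_edge_length[OF S(2)]
      by (intro closed_INT ballI closed_Collect_le continuous_on_const) simp
  qed
  moreover have "id \<in> C" unfolding C_iff by simp
  then have "C \<noteq> {}" by blast
  moreover have "continuous_on C (\<lambda>pos. edge_length pos f)"
    using continuous_on_subset[OF continuous_on_edge_length[OF S(2) f]] by simp
  ultimately obtain pos where pos: "pos \<in> C"
    "\<And>pos'. pos' \<in> C \<Longrightarrow> edge_length pos f \<le> edge_length pos' f"
    using continuous_attains_inf[of C "\<lambda>pos. edge_length pos f"] by blast
  have posN: "\<forall>t\<in>N. pos t = t" and pos_le: "\<forall>e\<in>edges T. edge_length pos e \<le> ?k e"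
    using pos(1) by (auto simp: C_iff)
  define T' where "T' = map_graph pos T"
  have inj: "inj_on pos (nodes T)" and T': "full_MSPT N T'" "same_topology N T T'"
    unfolding T'_def using full_MSPT_moved[OF T(1) posN pos_le] by blast+
  have no_bond: "\<not> collinear {pos s, pos a, pos b}"
    if s: "s \<in> nodes T - N" and ab: "adjacent T s a" "adjacent T s b" "a \<noteq> b" for s a b
  proof
    assume col: "collinear {pos s, pos a, pos b}"
    have nodes: "a \<in> nodes T" "b \<in> nodes T" "s \<noteq> a" "s \<noteq> b"
      using adjacent_nodes[OF S(2)] ab by blast+
    \<comment> \<open>A moved Steiner point cannot land on a terminal: \<open>pos\<close> fixes that
      terminal and is injective.\<close>
    have "pos s \<notin> N"
    proof
      assume "pos s \<in> N"
      then have "pos (pos s) = pos s" "pos s \<in> nodes T" using posN S(4) by auto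
      then have "pos s = s" using inj s by (auto dest: inj_onD)
      with \<open>pos s \<in> N\<close> s show False by simp
    qed
    then have "pos s \<in> nodes T' - N" using s by (simp add: T'_def map_graph_def)
    moreover have "pos ` {s, a} \<in> edges T'" "pos ` {s, b} \<in> edges T'"
      using ab unfolding T'_def map_graph_def adjacent_def by (simp_all only: graph.select_convs imageI)
    moreover have "pos a \<noteq> pos b" "pos s \<noteq> pos a" "pos s \<noteq> pos b"
      using inj nodes s ab(3) by (auto dest: inj_onD)
    then have "{pos s, pos a} \<noteq> {pos s, pos b}" by (auto simp: doubleton_eq_iff)
    moreover have "collinear ({pos s, pos a} \<union> {pos s, pos b})"
      using col by (simp add: insert_commute)
    ultimately have "Steiner_bond N T' {pos s, pos a} {pos s, pos b}"
      unfolding Steiner_bond_def by auto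
    then show False using T T' unfolding bond_free_def full_MSPT_def by blast
  qed

  have tight: "edge_length pos e0 = ?k e0" if e0: "e0 \<in> edges T" "e0 \<noteq> f" for e0
  proof (rule ccontr)
    assume "edge_length pos e0 \<noteq> ?k e0"
    then have slack: "edge_length pos e0 < ?k e0" using pos_le e0(1) by force
    have "\<exists>h. (\<forall>t\<in>N. h t = 0) \<and>
        (\<forall>u v. {u, v} \<in> edges T - {e0} \<longrightarrow> (pos u - pos v) \<bullet> (h u - h v) = - 1)"
      by (rule exists_contracting_velocities[OF S(1,4) M(2) e0(1)]) (rule no_bond)
    then obtain h where h: "\<forall>t\<in>N. h t = 0"
      "\<And>u v. {u, v} \<in> edges T - {e0} \<Longrightarrow> (pos u - pos v) \<bullet> (h u - h v) = - 1" by blast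
    \<comment> \<open>All Steiner points move linearly with velocities \<open>h\<close>. Since
      \<open>h\<close> vanishes on terminals, the same formula holds at every node of
      \<open>T\<close>.\<close>
    define q where "q s v = (if v \<in> nodes T - N then pos v + s *\<^sub>R h v else v)" for s v
    have q: "edge_length (q s) {u, v} = norm ((pos u - pos v) + s *\<^sub>R (h u - h v))"
      if "{u, v} \<in> edges T" for s u v
    proof -
      have "u \<in> nodes T" "v \<in> nodes T" using edges_subset_Pow[OF S(2)] that by auto
      then have "q s u = pos u + s *\<^sub>R h u" "q s v = pos v + s *\<^sub>R h v"
        using h(1) posN by (auto simp: q_def)
      then show ?thesis by (simp add: edge_length_doubleton dist_norm algebra_simps)
    qed
    have dec: "\<forall>\<^sub>F s in at_right 0. edge_length (q s) e < edge_length pos e"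
      if e: "e \<in> edges T - {e0}" for e
    proof -
      have "e \<in> edges T" using e by simp
      with S(2) obtain u v where uv: "e = {u, v}" by (rule edgeE)
      have "{u, v} \<in> edges T" "(pos u - pos v) \<bullet> (h u - h v) = - 1" using e h(2) uv by auto
      moreover have "edge_length pos {u, v} = norm (pos u - pos v)"
        by (simp add: edge_length_doubleton dist_norm)
      ultimately show ?thesis using eventually_norm_decreases unfolding uv by (simp only: q)
    qed
    \<comment> \<open>The exempted edge may grow, but its slack absorbs this for small
      \<open>s\<close> by continuity.\<close>
    have "\<forall>\<^sub>F s in at_right 0. edge_length (q s) e0 < ?k e0"
    proof -
      obtain u v where uv: "e0 = {u, v}" using S(2) e0(1) by (rule edgeE)
      then have e: "{u, v} \<in> edges T" using e0(1) by simp
      have "((\<lambda>s. norm ((pos u - pos v) + s *\<^sub>R (h u - h v))) \<longlongrightarrow>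
          norm ((pos u - pos v) + 0 *\<^sub>R (h u - h v))) (at_right 0)"
        by (intro tendsto_intros)
      moreover have "norm ((pos u - pos v) + 0 *\<^sub>R (h u - h v)) < ?k e0"
        using slack unfolding uv by (simp add: edge_length_doubleton dist_norm)
      ultimately have "\<forall>\<^sub>F s in at_right 0. norm ((pos u - pos v) + s *\<^sub>R (h u - h v)) < ?k e0"
        by (rule order_tendstoD(2))
      then show ?thesis unfolding uv q[OF e] .
    qed
    moreover have "\<forall>\<^sub>F s in at_right 0. \<forall>e\<in>edges T - {e0}. edge_length (q s) e < edge_length pos e"
      using fin(2) dec by (intro eventually_ball_finite) auto
    ultimately have "\<forall>\<^sub>F s in at_right 0. edge_length (q s) e0 < ?k e0 \<and>
        (\<forall>e\<in>edges T - {e0}. edge_length (q s) e < edge_length pos e)"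
      by (rule eventually_conj)
    then obtain s where s: "edge_length (q s) e0 < ?k e0"
      "\<And>e. e \<in> edges T - {e0} \<Longrightarrow> edge_length (q s) e < edge_length pos e"
      using eventually_happens'[OF trivial_limit_at_right_real] by blast
    have "edge_length (q s) e \<le> ?k e" if "e \<in> edges T" for e
      using s(1) s(2)[of e] pos_le that by (cases "e = e0") force+
    then have "q s \<in> C" unfolding C_iff by (simp add: q_def)
    then show False using pos(2)[of "q s"] s(2)[of f] f e0(2) by fastforce
  qed

  \<comment> \<open>Moving is injective on edges, so the tight edges, all but \<open>f\<close>,
    supply \<open>2 n - 4\<close> edges of integer length, where \<open>n = card N\<close>.\<close>
  have "(\<lambda>e. pos ` e) ` (edges T - {f}) \<subseteq> {e \<in> edges T'. edge_length id e \<in> \<int>}"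
  proof (rule image_subsetI)
    fix e assume e: "e \<in> edges T - {f}"
    then have "edge_length pos e \<in> \<int>" using tight[of e] by simp
    moreover have "edge_length id (pos ` e) = edge_length (id \<circ> pos) e"
      using e by (intro edge_length_image[OF S(2)]) simp
    ultimately show "pos ` e \<in> {e \<in> edges T'. edge_length id e \<in> \<int>}"
      using e by (simp add: T'_def map_graph_def)
  qed
  then have "card ((\<lambda>e. pos ` e) ` (edges T - {f})) \<le> card {e \<in> edges T'. edge_length id e \<in> \<int>}"
    using fin(2) by (intro card_mono) (auto simp: T'_def map_graph_def)
  moreover have "card ((\<lambda>e. pos ` e) ` (edges T - {f})) + 1 = card (edges T)"
    using card_image[OF inj_on_subset[OF inj_on_edges[OF S(2) inj]], of "edges T - {f}"]
      card_Suc_Diff1[OF fin(2) f] by simp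
  ultimately have "Z_packed N T'"
    using T'(1) cards(1) unfolding Z_packed_def full_MSPT_def MSPT_def by linarith
  with T'(1) show ?thesis unfolding full_MSPT_def by blast
qed

section \<open>The bead count of packed trees and the conclusion\<close>

text \<open>Integer summands pass through the ceiling, so at most one summand is really
  rounded.\<close>

lemma sum_ceiling_one_non_integer:
  fixes l :: "'a \<Rightarrow> real"
  assumes "finite E" "card {e \<in> E. l e \<notin> \<int>} \<le> 1"
  shows "(\<Sum>e\<in>E. \<lceil>l e\<rceil>) = \<lceil>\<Sum>e\<in>E. l e\<rceil>"
proof (cases "{e \<in> E. l e \<notin> \<int>} = {}")
  case True
  then have "(\<Sum>e\<in>E. l e) = (\<Sum>e\<in>E. of_int \<lceil>l e\<rceil>)" by (intro sum.cong) (auto elim: Ints_cases)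
  then show ?thesis by (simp flip: of_int_sum)
next
  case False
  then have "card {e \<in> E. l e \<notin> \<int>} = 1" using assms by (simp add: card_gt_0_iff le_antisym Suc_le_eq)
  then obtain f where f: "{e \<in> E. l e \<notin> \<int>} = {f}" by (rule card_1_singletonE)
  then have "f \<in> E" by blast
  have "l e = of_int \<lceil>l e\<rceil>" if e: "e \<in> E - {f}" for e
  proof -
    have "l e \<in> \<int>" using e f by blast
    then show ?thesis by (rule Ints_cases) simp
  qed
  then have "(\<Sum>e\<in>E - {f}. l e) = (\<Sum>e\<in>E - {f}. of_int \<lceil>l e\<rceil>)" by (intro sum.cong) auto
  then have "(\<Sum>e\<in>E - {f}. l e) = of_int (\<Sum>e\<in>E - {f}. \<lceil>l e\<rceil>)" by simp
  then have "(\<Sum>e\<in>E. l e) = l f + of_int (\<Sum>e\<in>E - {f}. \<lceil>l e\<rceil>)"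
    using sum.remove[OF assms(1) \<open>f \<in> E\<close>, of l] by simp
  then show ?thesis using sum.remove[OF assms(1) \<open>f \<in> E\<close>, of "\<lambda>e. \<lceil>l e\<rceil>"]
    by (simp only: ceiling_add_of_int)
qed

text \<open>Of the \<open>2 n - 3\<close> edges, where \<open>n = card N\<close>, at most one has
  non-integer length. Hence the bead count is a monotone function of the total length on packed
  trees.\<close>

lemma beads_Z_packed:
  assumes "Z_packed N T"
  shows "beads N T = 1 - int (card N) + \<lceil>total_length T\<rceil>"
proof -
  have T: "interconnects N T" "full_topology N T" "tree T" "N \<subseteq> nodes T"
    and Z: "int (card {e \<in> edges T. edge_length id e \<in> \<int>}) \<ge> 2 * int (card N) - 4"
    using assms by (auto simp: Z_packed_def interconnects_def)
  note cards = full_topology_card[OF T(3,4,2)]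
  have fin: "finite (edges T)" using T(3) edges_finite by (auto simp: tree_def)
  have "card (edges T) = card {e \<in> edges T. edge_length id e \<in> \<int>} + card {e \<in> edges T. edge_length id e \<notin> \<int>}"
    using fin by (subst card_Un_disjoint[symmetric]) (auto intro: arg_cong[of _ _ card])
  then have "card {e \<in> edges T. edge_length id e \<notin> \<int>} \<le> 1" using Z cards(1) by linarith
  then show ?thesis
    using beads_eq[OF T(1) cards(2)] sum_ceiling_one_non_integer[OF fin] by (simp add: total_length_def)
qed

theorem proposition27:
  fixes N :: "point set" and T :: "point graph"
  assumes "finite N"
    and "\<exists>T\<^sub>0. full_MSPT N T\<^sub>0 \<and> bond_free N T\<^sub>0"
    and "shortest_Z_packed N T"
  shows "MSPT N T"
proof -
  obtain T' where T': "MSPT N T'" "Z_packed N T'" using assms(2) exists_Z_packed_MSPT by blast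
  have T: "Z_packed N T" "total_length T \<le> total_length T'"
    using assms(3) T'(2) by (auto simp: shortest_Z_packed_def)
  \<comment> \<open>Both trees are packed, so comparing total lengths compares bead counts.\<close>
  have "beads N T \<le> beads N T'"
    using T(2) beads_Z_packed[OF T(1)] beads_Z_packed[OF T'(2)] by (simp add: ceiling_mono)
  then show ?thesis using T(1) T'(1) unfolding MSPT_def Z_packed_def by (meson order_trans)
qed

end
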